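(* Let $\Gamma$ be an analytic Jordan curve (without cusps) bounding the simply connected domain $\Omega$, and let $\Pi=H+CHC$ acting on $\Lambda_\sigma(\Gamma)$. Then $\Pi$ admits a fixed point $F\in\Lambda_\sigma(\Gamma)$ that is not identically zero if and only if there exist non-constant $f\in A(\Gamma)$ and $g\in A'(\Gamma)$ with $f=\bar g$ on $\Gamma$. Moreover, if such $f$ and $g$ exist, then $\Pi f=f$ and $\Pi g=g$.
   Context: Fix $0<\sigma<1$. $\Omega$ is the interior domain of $\Gamma$ and $\Omega':=\widehat{\mathbb C}\setminus\overline\Omega$ the exterior domain (containing $\infty$). $\Lambda_\sigma(\Gamma)$ is the space of complex-valued Hölder continuous functions of order $\sigma$ on $\Gamma$. $A(\Gamma)$ is the set of restrictions to $\Gamma$ of functions that are $\sigma$-Hölder continuous on $\overline\Omega$ and holomorphic in $\Omega$; $A'(\Gamma)$ is the set of restrictions to $\Gamma$ of functions that are $\sigma$-Hölder continuous on $\overline{\Omega'}$, holomorphic in $\Omega'$, and vanish at $\infty$. The Hilbert operator $H:\Lambda_\sigma(\Gamma)\to\Lambda_\sigma(\Gamma)$ sends $F$ to the boundary values on $\Gamma$, taken from inside $\Omega$, of the Cauchy integral $f_i(z)=\frac{1}{2\pi i}\int_\Gamma \frac{F(\zeta)}{\zeta-z}\,d\zeta$, $z\in\Omega$; $H$ is a continuous idempotent with range $A(\Gamma)$ and kernel $A'(\Gamma)$. $C$ denotes complex conjugation, $CF=\overline F$. ($\Pi F$ equals the boundary values from $\Omega$ of the double layer potential $\frac1\pi\int_\Gamma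 F(\zeta)\,\partial_{N_\zeta}\log|z-\zeta|\,ds_\zeta$.) *)

theory Defs
  imports "HOL-Complex_Analysis.Complex_Analysis"
begin

definition analytic_jordan_curve :: "(real \<Rightarrow> complex) \<Rightarrow> bool" where
  "analytic_jordan_curve \<gamma> \<longleftrightarrow>
     (\<exists>G S. open S \<and> (\<forall>t::real. complex_of_real t \<in> S) \<and> G holomorphic_on S \<and>
            (\<forall>t::real. \<gamma> t = G (complex_of_real t)) \<and>
            (\<forall>t::real. deriv G (complex_of_real t) \<noteq> 0)) \<and>
     (\<forall>t. \<gamma> (t + 1) = \<gamma> t) \<and> inj_on \<gamma> {0..<1}"

definition holder_on :: "real \<Rightarrow> complex set \<Rightarrow> (complex \<Rightarrow> complex) \<Rightarrow> bool" where
  "holder_on \<sigma> S f \<longleftrightarrow> (\<exists>M. \<forall>x\<in>S. \<forall>y\<in>S. norm (f x - f y) \<le> M * dist x y powr \<sigma>)"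

text \<open>\<Lambda>_\<sigma>(\<Gamma>): functions on \<Gamma> (represented as functions on complex; only
  values on \<Gamma> matter) that are \<sigma>-Hoelder on \<Gamma>.\<close>
definition Lambda_sigma :: "real \<Rightarrow> complex set \<Rightarrow> (complex \<Rightarrow> complex) set" where
  "Lambda_sigma \<sigma> \<Gamma> = {F. holder_on \<sigma> \<Gamma> F}"

definition A_space :: "real \<Rightarrow> complex set \<Rightarrow> (complex \<Rightarrow> complex) set" where
  "A_space \<sigma> \<Gamma> = {F. \<exists>f. holder_on \<sigma> (closure (inside \<Gamma>)) f \<and> f holomorphic_on inside \<Gamma> \<and>
                          (\<forall>z\<in>\<Gamma>. F z = f z)}"

definition A'_space :: "real \<Rightarrow> complex set \<Rightarrow> (complex \<Rightarrow> complex) set" where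
  "A'_space \<sigma> \<Gamma> = {F. \<exists>g. holder_on \<sigma> (closure (outside \<Gamma>)) g \<and> g holomorphic_on outside \<Gamma> \<and>
                          (g \<longlongrightarrow> 0) at_infinity \<and> (\<forall>z\<in>\<Gamma>. F z = g z)}"

definition cauchy_int :: "(real \<Rightarrow> complex) \<Rightarrow> (complex \<Rightarrow> complex) \<Rightarrow> complex \<Rightarrow> complex" where
  "cauchy_int \<gamma> F z = contour_integral \<gamma> (\<lambda>\<zeta>. F \<zeta> / (\<zeta> - z)) / (2 * pi * \<i>)"

definition hilbert_op :: "(real \<Rightarrow> complex) \<Rightarrow> (complex \<Rightarrow> complex) \<Rightarrow> complex \<Rightarrow> complex" where
  "hilbert_op \<gamma> F z0 = Lim (at z0 within inside (path_image \<gamma>)) (cauchy_int \<gamma> F)"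

definition conj_op :: "(complex \<Rightarrow> complex) \<Rightarrow> complex \<Rightarrow> complex" where
  "conj_op F = (\<lambda>z. cnj (F z))"

definition Pi_op :: "(real \<Rightarrow> complex) \<Rightarrow> (complex \<Rightarrow> complex) \<Rightarrow> complex \<Rightarrow> complex" where
  "Pi_op \<gamma> F = (\<lambda>z. hilbert_op \<gamma> F z + conj_op (hilbert_op \<gamma> (conj_op F)) z)"

end

theory Submission
  imports Defs
begin

text \<open>
  For a Hoelder density \<open>F\<close> the Cauchy integral extends to Hoelder functions \<open>u\<close>, \<open>v\<close> on the closed interior
  and exterior, with \<open>u - v = F\<close> on the curve (Plemelj-Privalov). Both boundary functions are
  expressed by the absolutely convergent integral of \<open>(F \<zeta> - F a) / (\<zeta> - a)\<close>, and every estimate comes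
  down to \<open>\<integral> \<bar>\<zeta> - a\<bar> powr (\<sigma> - 1) * d / (\<bar>\<zeta> - a\<bar> + d) \<le> C * d powr \<sigma>\<close>.

  An analytic arc is removable for continuous functions, so a function continuous on the plane,
  holomorphic off the curve and vanishing at infinity is zero by Liouville. Hence
  \<open>A(\<Gamma>) \<inter> A'(\<Gamma>) = 0\<close> and \<open>\<Lambda>\<^sub>\<sigma>(\<Gamma>) = A(\<Gamma>) \<oplus> A'(\<Gamma>)\<close> with \<open>H\<close> the projection onto \<open>A(\<Gamma>)\<close>; no Cauchy theorem
  up to the boundary is needed. If \<open>\<Pi> F = F\<close> then \<open>F - H F = C H C F\<close>, so that
  \<open>C H F\<close> and \<open>C H C F\<close> lie in \<open>A'(\<Gamma>)\<close>, and whichever of \<open>H F\<close>, \<open>H C F\<close> is nonzero is the required \<open>f\<close>.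
\<close>

subsection \<open>Regular Jordan curves\<close>

text \<open>The parametrisation is C1 and periodic on the whole real line, so a pair of parameters
  can be shifted by a common integer instead of wrapping around at the base point. The estimates
  rest on this C1 structure; analyticity enters in \<open>holomorphic_across_curve\<close>.\<close>

locale regular_jordan_curve =
  fixes \<gamma> \<gamma>' :: "real \<Rightarrow> complex"
  assumes has_deriv: "\<And>t. (\<gamma> has_vector_derivative \<gamma>' t) (at t)"
    and cont_deriv: "continuous_on UNIV \<gamma>'"
    and deriv_nz: "\<And>t. \<gamma>' t \<noteq> 0"
    and periodic: "\<And>t. \<gamma> (t + 1) = \<gamma> t"
    and inj: "inj_on \<gamma> {0..<1}"
begin

lemma continuous_curve: "continuous_on S \<gamma>"
  by (meson has_deriv continuous_at_imp_continuous_on has_vector_derivative_continuous)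

lemma periodic_int: "\<gamma> (t + of_int k) = \<gamma> t"
proof (induction k)
  case (neg n)
  have "\<gamma> (t - real n) = \<gamma> t" for n
  proof (induction n)
    case (Suc n)
    then show ?case using periodic[of "t - real (Suc n)"] by (simp add: algebra_simps)
  qed auto
  from this[of "Suc n"] show ?case by (simp add: algebra_simps)
next
  case (nonneg n)
  show ?case
  proof (induction n)
    case (Suc n)
    then show ?case using periodic[of "t + real n"] by (simp add: algebra_simps)
  qed auto
qed

lemma deriv_periodic: "\<gamma>' (t + of_int k) = \<gamma>' t"
proof -
  have "((\<lambda>t. \<gamma> (t + of_int k)) has_vector_derivative \<gamma>' (t + of_int k)) (at t)"
    using has_deriv[of "t + of_int k"]
    by (auto intro!: derivative_eq_intros vector_diff_chain_at[where f="\<lambda>t. t + of_int k" and g=\<gamma> and f'=1, unfolded o_def, simplified])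
  then have "(\<gamma> has_vector_derivative \<gamma>' (t + of_int k)) (at t)"
    by (simp add: periodic_int)
  then show ?thesis using has_deriv vector_derivative_unique_at by blast
qed

lemma curve_frac: "\<gamma> (frac t) = \<gamma> t" and deriv_frac: "\<gamma>' (frac t) = \<gamma>' t"
  using periodic_int[of "frac t" "\<lfloor>t\<rfloor>"] deriv_periodic[of "frac t" "\<lfloor>t\<rfloor>"] by (auto simp: frac_def)

lemma curve_eqD:
  assumes "\<gamma> s = \<gamma> t" obtains k where "s - t = of_int k"
proof -
  have "frac s = frac t"
    using assms inj curve_frac by (metis atLeastLessThan_iff frac_ge_0 frac_lt_1 inj_onD)
  then have "s - t = of_int (\<lfloor>s\<rfloor> - \<lfloor>t\<rfloor>)" by (simp add: frac_def)
  then show thesis by (rule that)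
qed

lemma range_curve: "range \<gamma> = path_image \<gamma>"
proof -
  have "\<gamma> t \<in> path_image \<gamma>" for t
    unfolding path_image_def
    by (rule image_eqI[of _ _ "frac t"]) (auto simp: curve_frac frac_ge_0 frac_lt_1 less_imp_le)
  then show ?thesis by (auto simp: path_image_def)
qed

lemma curve_in [simp]: "\<gamma> t \<in> path_image \<gamma>"
  using range_curve by auto

lemma simple_path_curve: "simple_path \<gamma>"
proof (rule simple_pathI)
  show "path \<gamma>" by (simp add: path_def continuous_curve)
  fix x y :: real assume xy: "0 \<le> x" "x < y" "y \<le> 1" "\<gamma> x = \<gamma> y"
  obtain k where k: "y - x = of_int k" using curve_eqD xy(4) by metis
  then have "0 < k" using xy by simp
  then have "1 \<le> y - x" unfolding k by simp
  then show "x = 0 \<and> y = 1" using xy by linarith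
qed

lemma closed_curve: "pathfinish \<gamma> = pathstart \<gamma>"
  using periodic[of 0] by (simp add: pathfinish_def pathstart_def)

lemma jordan:
  "closure (inside (path_image \<gamma>)) = inside (path_image \<gamma>) \<union> path_image \<gamma>"
  "closure (outside (path_image \<gamma>)) = outside (path_image \<gamma>) \<union> path_image \<gamma>"
  "open (inside (path_image \<gamma>))" "open (outside (path_image \<gamma>))"
  "inside (path_image \<gamma>) \<union> outside (path_image \<gamma>) = - path_image \<gamma>"
  "inside (path_image \<gamma>) \<inter> outside (path_image \<gamma>) = {}"
  using Jordan_inside_outside[OF simple_path_curve closed_curve]
  by (auto simp: closure_Un_frontier)

lemma off_curve:
  "z \<in> inside (path_image \<gamma>) \<Longrightarrow> z \<notin> path_image \<gamma>" "z \<in> outside (path_image \<gamma>) \<Longrightarrow> z \<notin> path_image \<gamma>"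
  using jordan(5) by blast+

lemma winding_outside: "z \<in> outside (path_image \<gamma>) \<Longrightarrow> winding_number \<gamma> z = 0"
  using winding_number_zero_in_outside simple_path_curve closed_curve simple_path_imp_path by blast

lemma vector_derivative_curve [simp]: "vector_derivative \<gamma> (at t) = \<gamma>' t"
  using has_deriv by (rule vector_derivative_at)

lemma valid_path_curve: "valid_path \<gamma>"
proof -
  have "\<gamma> C1_differentiable_on {0..1}"
    unfolding C1_differentiable_on_def using has_deriv cont_deriv continuous_on_subset by blast
  then show ?thesis by (simp add: valid_path_def C1_differentiable_imp_piecewise)
qed

section \<open>Uniform metric estimates for the parametrisation\<close>

lemma deriv_bounded_below: "\<exists>m>0. \<forall>t. m \<le> norm (\<gamma>' t)"
  and deriv_bounded: "\<exists>L\<ge>0. \<forall>t. norm (\<gamma>' t) \<le> L"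
proof -
  have c: "continuous_on {0..1} (\<lambda>t. norm (\<gamma>' t))"
    using cont_deriv by (intro continuous_intros) (auto intro: continuous_on_subset)
  have fr: "frac t \<in> {0..1}" for t::real by (auto simp: frac_ge_0 frac_lt_1 less_imp_le)
  obtain x where "\<forall>t\<in>{0..1}. norm (\<gamma>' x) \<le> norm (\<gamma>' t)"
    using continuous_attains_inf[OF _ _ c] by auto
  then show "\<exists>m>0. \<forall>t. m \<le> norm (\<gamma>' t)"
    using fr deriv_nz[of x] by (intro exI[of _ "norm (\<gamma>' x)"]) (metis deriv_frac zero_less_norm_iff)
  obtain y where "\<forall>t\<in>{0..1}. norm (\<gamma>' t) \<le> norm (\<gamma>' y)"
    using continuous_attains_sup[OF _ _ c] by auto
  then show "\<exists>L\<ge>0. \<forall>t. norm (\<gamma>' t) \<le> L"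
    using fr by (intro exI[of _ "norm (\<gamma>' y)"]) (metis deriv_frac norm_ge_zero)
qed

text \<open>Uniformity in \<open>s\<close> comes from uniform continuity of \<open>\<gamma>'\<close>
  on a compact interval that contains a period with room on both sides; a common integer shift
  brings every pair of nearby parameters into it.\<close>

lemma linear_approximation:
  assumes "0 < e"
  obtains r where "0 < r" "\<And>s t. \<bar>t - s\<bar> \<le> r \<Longrightarrow> norm (\<gamma> t - \<gamma> s - (t - s) *\<^sub>R \<gamma>' s) \<le> e * \<bar>t - s\<bar>"
proof -
  have "uniformly_continuous_on {-1..2} \<gamma>'"
    using cont_deriv by (intro compact_uniformly_continuous) (auto intro: continuous_on_subset)
  then obtain d where d: "0 < d" "\<And>x y. x \<in> {-1..2} \<Longrightarrow> y \<in> {-1..2} \<Longrightarrow> dist x y < d \<Longrightarrow> dist (\<gamma>' x) (\<gamma>' y) < e"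
    using assms unfolding uniformly_continuous_on_def by (metis dist_commute)
  define r where "r = min (1/2) (d/2)"
  have r: "0 < r" "r < d" "r < 1" using d by (auto simp: r_def)
  have "norm (\<gamma> t - \<gamma> s - (t - s) *\<^sub>R \<gamma>' s) \<le> e * \<bar>t - s\<bar>" if "\<bar>t - s\<bar> \<le> r" for s t
  proof -
    define s0 t0 where "s0 = s + of_int (-\<lfloor>s\<rfloor>)" and "t0 = t + of_int (-\<lfloor>s\<rfloor>)"
    have s0: "0 \<le> s0" "s0 < 1" unfolding s0_def by linarith+
    have ts: "t0 - s0 = t - s" by (simp add: s0_def t0_def)
    have seg: "x \<in> {-1..2} \<and> dist x s0 < d" if "x \<in> closed_segment s0 t0" for x
      using that s0 ts r \<open>\<bar>t - s\<bar> \<le> r\<close> by (auto simp: closed_segment_eq_real_ivl dist_real_def split: if_splits)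
    have "norm (\<gamma> t0 - \<gamma> s0 - (t0 - s0) *\<^sub>R \<gamma>' s0) \<le> norm (t0 - s0) * e"
    proof (rule vector_differentiable_bound_linearization[where S="closed_segment s0 t0"])
      show "norm (\<gamma>' x - \<gamma>' s0) \<le> e" if "x \<in> closed_segment s0 t0" for x
        using d(2)[of x s0] seg[OF that] s0 by (simp add: dist_norm less_imp_le)
    qed (auto intro: has_deriv has_vector_derivative_at_within)
    then show ?thesis
      unfolding ts by (simp add: s0_def t0_def periodic_int[of _ "-\<lfloor>s\<rfloor>", simplified] deriv_periodic[of _ "-\<lfloor>s\<rfloor>", simplified] mult.commute)
  qed
  then show thesis using that r by blast
qed

text \<open>Close to the diagonal the lower bound is that of the derivative, with half of it lost to
  the linearisation error. Away from the diagonal it comes from compactness and injectivity modulo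
  1; the range 1/2 is half a period and excludes distinct parameters of the same point.\<close>

lemma chord_arc:
  obtains c where "0 < c" "\<And>s t. \<bar>t - s\<bar> \<le> 1/2 \<Longrightarrow> c * \<bar>t - s\<bar> \<le> norm (\<gamma> t - \<gamma> s)"
proof -
  obtain m where m: "0 < m" "\<And>t. m \<le> norm (\<gamma>' t)" using deriv_bounded_below by auto
  obtain r where r: "0 < r" "\<And>s t. \<bar>t - s\<bar> \<le> r \<Longrightarrow> norm (\<gamma> t - \<gamma> s - (t - s) *\<^sub>R \<gamma>' s) \<le> (m/2) * \<bar>t - s\<bar>"
    using linear_approximation[of "m/2"] m by auto
  have loc: "m/2 * \<bar>t - s\<bar> \<le> norm (\<gamma> t - \<gamma> s)" if "\<bar>t - s\<bar> \<le> r" for s t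
  proof -
    have "m * \<bar>t - s\<bar> \<le> norm ((t - s) *\<^sub>R \<gamma>' s)"
      using m(2)[of s] by (simp add: mult.commute[of _ "\<bar>t - s\<bar>"] mult_left_mono)
    also have "\<dots> \<le> norm (\<gamma> t - \<gamma> s) + norm (\<gamma> t - \<gamma> s - (t - s) *\<^sub>R \<gamma>' s)"
      by (metis norm_minus_commute norm_triangle_sub add.commute)
    finally show ?thesis using r(2)[OF that] by linarith
  qed
  define T where "T = ({0..1} \<times> {-1..2::real}) \<inter> {p. min r (1/2) \<le> \<bar>snd p - fst p\<bar> \<and> \<bar>snd p - fst p\<bar> \<le> 1/2}"
  have "compact T" unfolding T_def
    by (intro compact_Int_closed compact_Times compact_Icc closed_Collect_conj closed_Collect_le continuous_intros)
  moreover have "(0, 1/2) \<in> T" by (auto simp: T_def)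
  moreover have "continuous_on T (\<lambda>p. norm (\<gamma> (snd p) - \<gamma> (fst p)))"
    by (intro continuous_intros continuous_on_compose2[OF continuous_curve[of UNIV]]) auto
  ultimately have "\<exists>p\<in>T. \<forall>q\<in>T. norm (\<gamma> (snd p) - \<gamma> (fst p)) \<le> norm (\<gamma> (snd q) - \<gamma> (fst q))"
    by (intro continuous_attains_inf) auto
  then obtain p where p: "p \<in> T" "\<forall>q\<in>T. norm (\<gamma> (snd p) - \<gamma> (fst p)) \<le> norm (\<gamma> (snd q) - \<gamma> (fst q))"
    by blast
  define \<mu> where "\<mu> = norm (\<gamma> (snd p) - \<gamma> (fst p))"
  \<comment> \<open>A zero minimum would make \<open>snd p - fst p\<close> an integer, while
    membership in \<open>T\<close> puts its absolute value strictly above 0 and at most 1/2.\<close>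
  have "\<mu> > 0"
  proof (rule ccontr)
    assume "\<not> \<mu> > 0"
    then have "\<gamma> (snd p) = \<gamma> (fst p)" by (simp add: \<mu>_def)
    then obtain k where k: "snd p - fst p = of_int k" using curve_eqD by metis
    have "\<bar>of_int k :: real\<bar> \<le> 1/2" "0 < \<bar>of_int k :: real\<bar>"
      unfolding k[symmetric] using p(1) r(1) unfolding T_def by auto
    moreover from this(2) have "1 \<le> \<bar>of_int k :: real\<bar>"
      by (metis of_int_abs of_int_1_le_iff of_int_0_less_iff int_one_le_iff_zero_less)
    ultimately show False by linarith
  qed
  \<comment> \<open>The constant lower bound \<mu> becomes a linear one because
    \<open>\<bar>t - s\<bar> \<le> 1/2\<close>; hence the factor 2.\<close>
  have glob: "2 * \<mu> * \<bar>t - s\<bar> \<le> norm (\<gamma> t - \<gamma> s)" if "\<bar>t - s\<bar> \<le> 1/2" "r \<le> \<bar>t - s\<bar>" for s t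
  proof -
    define s0 t0 where "s0 = s + of_int (-\<lfloor>s\<rfloor>)" and "t0 = t + of_int (-\<lfloor>s\<rfloor>)"
    have s0: "0 \<le> s0" "s0 < 1" unfolding s0_def by linarith+
    have ts: "t0 - s0 = t - s" by (simp add: s0_def t0_def)
    have "-1 \<le> t0" "t0 \<le> 2" using s0 ts that(1) by linarith+
    then have "(s0, t0) \<in> T" using s0 ts that unfolding T_def by auto
    then have "\<mu> \<le> norm (\<gamma> t0 - \<gamma> s0)" using p(2) unfolding \<mu>_def by fastforce
    also have "\<dots> = norm (\<gamma> t - \<gamma> s)" unfolding s0_def t0_def periodic_int ..
    finally have "\<mu> \<le> norm (\<gamma> t - \<gamma> s)" .
    moreover have "\<mu> * \<bar>t - s\<bar> \<le> \<mu> * (1/2)" using that(1) \<open>\<mu> > 0\<close> by (intro mult_left_mono) auto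
    ultimately show ?thesis by linarith
  qed
  show thesis
  proof (rule that[of "min (m/2) (2*\<mu>)"])
    show "0 < min (m/2) (2*\<mu>)" using m \<open>\<mu> > 0\<close> by auto
    fix s t :: real assume st: "\<bar>t - s\<bar> \<le> 1/2"
    have "min (m/2) (2*\<mu>) * \<bar>t - s\<bar> \<le> m/2 * \<bar>t - s\<bar>" "min (m/2) (2*\<mu>) * \<bar>t - s\<bar> \<le> 2*\<mu> * \<bar>t - s\<bar>"
      by (intro mult_right_mono; simp)+
    then show "min (m/2) (2*\<mu>) * \<bar>t - s\<bar> \<le> norm (\<gamma> t - \<gamma> s)"
      using loc[of t s] glob[of t s] st by (cases "\<bar>t - s\<bar> \<le> r") auto
  qed
qed

lemma nearby_parameter:
  obtains t' where "\<gamma> t' = \<gamma> t" "\<bar>t' - s\<bar> \<le> 1/2"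
proof -
  have "\<gamma> (t + of_int (- round (t - s))) = \<gamma> t" by (rule periodic_int)
  moreover have "\<bar>t + of_int (- round (t - s)) - s\<bar> \<le> 1/2"
    using of_int_round_abs_le[of "t - s"] by (simp add: abs_minus_commute algebra_simps)
  ultimately show thesis by (rule that)
qed

text \<open>The point \<open>z\<close> is found on the normal at \<open>a\<close>; scales above a fixed \<open>\<eta>0\<close> only cost a larger \<open>K\<close>.\<close>

lemma corkscrew:
  obtains K where "1 \<le> K"
    "\<And>a \<epsilon>. a \<in> path_image \<gamma> \<Longrightarrow> 0 < \<epsilon> \<Longrightarrow> \<epsilon> \<le> D \<Longrightarrow>
       \<exists>z. norm (z - a) \<le> K * \<epsilon> \<and> (\<forall>\<zeta>\<in>path_image \<gamma>. \<epsilon> \<le> K * norm (\<zeta> - z))"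
proof -
  obtain m where m: "0 < m" "\<And>t. m \<le> norm (\<gamma>' t)" using deriv_bounded_below by auto
  obtain L where mL: "\<And>t. norm (\<gamma>' t) \<le> L" using deriv_bounded by auto
  obtain r where r: "0 < r" "\<And>s t. \<bar>t - s\<bar> \<le> r \<Longrightarrow> norm (\<gamma> t - \<gamma> s - (t - s) *\<^sub>R \<gamma>' s) \<le> (m/2) * \<bar>t - s\<bar>"
    using linear_approximation[of "m/2"] m by auto
  obtain c where c: "0 < c" "\<And>s t. \<bar>t - s\<bar> \<le> 1/2 \<Longrightarrow> c * \<bar>t - s\<bar> \<le> norm (\<gamma> t - \<gamma> s)" using chord_arc by blast
  have L: "0 < L" "m \<le> L" using m(1) m(2)[of 0] mL[of 0] by linarith+
  \<comment> \<open>For \<open>\<eta> \<le> \<eta>0\<close> the displacement along the normal is at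
    most half of \<open>c * r\<close>, and \<open>c * r\<close> bounds from below the distance of
    \<open>\<gamma> s\<close> to the points whose nearby parameter differs from \<open>s\<close> by
    more than \<open>r\<close>.\<close>
  define \<eta>0 where "\<eta>0 = c * r / (2 * L)"
  have \<eta>0: "0 < \<eta>0" using c r L by (simp add: \<eta>0_def)
  have key: "m/2 * \<eta> \<le> norm (\<gamma> t - (\<gamma> s + \<i> * \<eta> * \<gamma>' s))" if \<eta>: "0 < \<eta>" "\<eta> \<le> \<eta>0" for s t \<eta> :: real
  proof -
    obtain t' where t': "\<gamma> t' = \<gamma> t" "\<bar>t' - s\<bar> \<le> 1/2" by (rule nearby_parameter)
    define z where "z = \<gamma> s + \<i> * \<eta> * \<gamma>' s"
    show ?thesis
    proof (cases "\<bar>t' - s\<bar> \<le> r")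
      case True
      \<comment> \<open>Tangential offset \<open>t' - s\<close> and normal offset
        \<open>-\<eta>\<close> combine into one complex multiple of \<open>\<gamma>' s\<close>: the
        main term is at least \<open>m * norm w\<close>, the linearisation error at most half of
        that.\<close>
      define w where "w = Complex (t' - s) (-\<eta>)"
      have w: "\<bar>t' - s\<bar> \<le> norm w" "\<eta> \<le> norm w"
        using abs_Re_le_cmod[of w] abs_Im_le_cmod[of w] \<eta> by (auto simp: w_def)
      have "(t' - s) *\<^sub>R \<gamma>' s - \<i> * \<eta> * \<gamma>' s = w * \<gamma>' s"
        by (simp add: w_def complex_eq_iff)
      then have "\<gamma> t' - z = w * \<gamma>' s + (\<gamma> t' - \<gamma> s - (t' - s) *\<^sub>R \<gamma>' s)"
        by (simp add: z_def algebra_simps)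
      then have "norm (w * \<gamma>' s) - norm (\<gamma> t' - \<gamma> s - (t' - s) *\<^sub>R \<gamma>' s) \<le> norm (\<gamma> t' - z)"
        by (metis norm_diff_ineq)
      then have "norm w * norm (\<gamma>' s) - m/2 * \<bar>t' - s\<bar> \<le> norm (\<gamma> t' - z)"
        using r(2)[OF True] unfolding norm_mult by linarith
      moreover have "norm w * m \<le> norm w * norm (\<gamma>' s)" using m(2) by (intro mult_left_mono) auto
      moreover have "m/2 * \<bar>t' - s\<bar> \<le> m/2 * norm w" using w m by (intro mult_left_mono) auto
      moreover have "m/2 * \<eta> \<le> m/2 * norm w" using w m by (intro mult_left_mono) auto
      ultimately have "m/2 * \<eta> \<le> norm (\<gamma> t' - z)" by (simp add: mult.commute)
      then show ?thesis by (simp add: z_def t')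
    next
      case False
      have "c * r \<le> norm (\<gamma> t' - \<gamma> s)"
        using c(2)[OF t'(2)] False c(1) by (smt (verit) mult_left_mono)
      also have "\<dots> \<le> norm (\<gamma> t' - z) + norm (z - \<gamma> s)" by norm
      also have "norm (z - \<gamma> s) = \<eta> * norm (\<gamma>' s)" using \<eta> by (simp add: z_def norm_mult)
      also have "\<dots> \<le> \<eta> * L" using \<eta> mL by (intro mult_left_mono) auto
      finally have "c * r - \<eta> * L \<le> norm (\<gamma> t' - z)" by simp
      moreover have "2 * (\<eta> * L) \<le> c * r" using \<eta>(2) L by (simp add: \<eta>0_def field_simps)
      moreover have "m/2 * \<eta> \<le> L * \<eta>" using L m \<eta> by (intro mult_right_mono) auto
      ultimately show ?thesis by (simp add: z_def t' mult.commute)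
    qed
  qed
  define E where "E = max 1 (D / \<eta>0)"
  have E: "1 \<le> E" "D \<le> E * \<eta>0" using \<eta>0 by (auto simp: E_def max_def field_simps)
  define K where "K = max 1 (max L (2 * E / m))"
  have K: "1 \<le> K" "L \<le> K" "2 * E / m \<le> K" by (auto simp: K_def)
  show thesis
  proof (rule that[OF K(1)])
    fix a \<epsilon> assume a: "a \<in> path_image \<gamma>" and \<epsilon>: "0 < \<epsilon>" "\<epsilon> \<le> D"
    obtain s where s: "a = \<gamma> s" using a by (auto simp: path_image_def)
    define \<eta> where "\<eta> = \<epsilon> / E"
    have \<eta>: "0 < \<eta>" "\<eta> \<le> \<epsilon>" "\<eta> \<le> \<eta>0" using E \<epsilon> by (auto simp: \<eta>_def field_simps intro: order_trans)
    define z where "z = \<gamma> s + \<i> * \<eta> * \<gamma>' s"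
    have "norm (z - a) = \<eta> * norm (\<gamma>' s)" using \<eta> by (simp add: z_def s norm_mult)
    also have "\<dots> \<le> \<epsilon> * K" using \<eta> mL[of s] K by (intro mult_mono) auto
    finally have "norm (z - a) \<le> K * \<epsilon>" by (simp add: mult.commute)
    moreover have "\<epsilon> \<le> K * norm (\<zeta> - z)" if \<zeta>: "\<zeta> \<in> path_image \<gamma>" for \<zeta>
    proof -
      obtain t where t: "\<zeta> = \<gamma> t" using \<zeta> range_curve by (metis rangeE)
      have "\<epsilon> = 2 * E / m * (m/2 * \<eta>)" using m E by (simp add: \<eta>_def)
      also have "\<dots> \<le> K * norm (\<zeta> - z)"
        using key[OF \<eta>(1,3), of t s] K m E \<eta> unfolding t z_def by (intro mult_mono) auto
      finally show ?thesis .
    qed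
    ultimately show "\<exists>z. norm (z - a) \<le> K * \<epsilon> \<and> (\<forall>\<zeta>\<in>path_image \<gamma>. \<epsilon> \<le> K * norm (\<zeta> - z))" by blast
  qed
qed

end

subsection \<open>The weakly singular kernel\<close>

text \<open>The kernel \<open>x powr (\<sigma> - 1) * d / (x + d)\<close> with
  \<open>d / (x + d)\<close> replaced by the smaller of 1 and \<open>d / x\<close>. The value 0 for
  \<open>x \<le> 0\<close> lets the sum of the terms at \<open>c * (t - p)\<close> and
  \<open>c * (p - t)\<close> represent a function of \<open>\<bar>t - p\<bar>\<close>.\<close>

definition kernel_majorant :: "real \<Rightarrow> real \<Rightarrow> real \<Rightarrow> real" where
  "kernel_majorant \<sigma> d x = (if x \<le> 0 then 0 else if x \<le> d then x powr (\<sigma> - 1) else d * x powr (\<sigma> - 2))"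

text \<open>The continuous antiderivative of \<open>kernel_majorant\<close> that vanishes for
  \<open>x \<le> 0\<close>. The cut-offs by \<open>min\<close> and \<open>max\<close> merge the
  three pieces into one formula, from which continuity at 0 and \<open>d\<close> is
  immediate.\<close>

definition kernel_primitive :: "real \<Rightarrow> real \<Rightarrow> real \<Rightarrow> real" where
  "kernel_primitive \<sigma> d x =
     min (max x 0) d powr \<sigma> / \<sigma> + d * (d powr (\<sigma> - 1) - max x d powr (\<sigma> - 1)) / (1 - \<sigma>)"

lemma kernel_majorant_nonneg: "0 < d \<Longrightarrow> 0 \<le> kernel_majorant \<sigma> d x"
  by (simp add: kernel_majorant_def)

text \<open>In the application \<open>u\<close> is a distance on the curve and \<open>v\<close> its
  chord-arc lower bound. The power decreases in \<open>u\<close>, and \<open>d / (u + d)\<close> is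
  bounded once by 1 and once by \<open>d / v\<close>.\<close>

lemma kernel_le_majorant:
  assumes "\<sigma> < 1" "0 < d" "0 < v" "v \<le> u"
  shows "u powr (\<sigma> - 1) * d / (u + d) \<le> kernel_majorant \<sigma> d v"
proof -
  have 1: "u powr (\<sigma> - 1) \<le> v powr (\<sigma> - 1)" using assms by (intro powr_mono2') auto
  have 2: "d / (u + d) \<le> 1" using assms by simp
  have 3: "d / (u + d) \<le> d / v" using assms by (intro divide_left_mono) auto
  have "v powr (\<sigma> - 1) * (d / v) = d * v powr (\<sigma> - 2)"
    using assms by (simp add: powr_diff power2_eq_square field_simps)
  moreover have "u powr (\<sigma> - 1) * (d / (u + d)) \<le> v powr (\<sigma> - 1) * 1"
    "u powr (\<sigma> - 1) * (d / (u + d)) \<le> v powr (\<sigma> - 1) * (d / v)"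
    using 1 2 3 assms by (intro mult_mono; auto)+
  ultimately show ?thesis using assms by (auto simp: kernel_majorant_def)
qed

lemma kernel_primitive_bounds:
  assumes "0 < \<sigma>" "\<sigma> < 1" "0 < d"
  shows "0 \<le> kernel_primitive \<sigma> d x" "kernel_primitive \<sigma> d x \<le> (1 / \<sigma> + 1 / (1 - \<sigma>)) * d powr \<sigma>"
proof -
  have 1: "max x d powr (\<sigma> - 1) \<le> d powr (\<sigma> - 1)" using assms by (intro powr_mono2') auto
  show "0 \<le> kernel_primitive \<sigma> d x"
    unfolding kernel_primitive_def using assms 1 by (intro add_nonneg_nonneg divide_nonneg_nonneg mult_nonneg_nonneg) auto
  have 2: "min (max x 0) d powr \<sigma> \<le> d powr \<sigma>" using assms by (intro powr_mono2) auto
  have 3: "d * (d powr (\<sigma> - 1) - max x d powr (\<sigma> - 1)) \<le> d powr \<sigma>"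
    using assms by (simp add: right_diff_distrib powr_mult_base)
  have "kernel_primitive \<sigma> d x \<le> d powr \<sigma> / \<sigma> + d powr \<sigma> / (1 - \<sigma>)"
    unfolding kernel_primitive_def using assms 2 3 by (intro add_mono divide_right_mono) auto
  then show "kernel_primitive \<sigma> d x \<le> (1 / \<sigma> + 1 / (1 - \<sigma>)) * d powr \<sigma>" by (simp add: field_simps)
qed

lemma continuous_on_kernel_primitive:
  assumes "0 < \<sigma>" "0 < d" "continuous_on S f"
  shows "continuous_on S (\<lambda>x. kernel_primitive \<sigma> d (f x))"
proof -
  have "continuous_on S (\<lambda>x. min (max (f x) 0) d powr \<sigma>)"
    using assms by (intro continuous_on_powr' continuous_intros) auto
  moreover have "continuous_on S (\<lambda>x. max (f x) d powr (\<sigma> - 1))"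
    using assms by (intro continuous_on_powr continuous_intros) auto
  ultimately show ?thesis unfolding kernel_primitive_def divide_inverse
    by (intro continuous_on_add continuous_on_mult continuous_on_diff continuous_on_const)
qed

lemma DERIV_kernel_primitive:
  assumes "0 < \<sigma>" "\<sigma> < 1" "0 < d" "x \<noteq> 0" "x \<noteq> d"
  shows "(kernel_primitive \<sigma> d has_real_derivative kernel_majorant \<sigma> d x) (at x)"
proof -
  consider "x < 0" | "0 < x" "x < d" | "d < x" using assms by linarith
  then show ?thesis
  proof cases
    case 1
    have "((\<lambda>x. 0) has_real_derivative 0) (at x)" by simp
    then have "(kernel_primitive \<sigma> d has_real_derivative 0) (at x)"
      by (rule has_field_derivative_transform_within_open[where S="{..<0}"])
         (use 1 assms in \<open>auto simp: kernel_primitive_def\<close>)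
    then show ?thesis using 1 by (simp add: kernel_majorant_def)
  next
    case 2
    have "((\<lambda>x. x powr \<sigma> / \<sigma>) has_real_derivative (\<sigma> * x powr (\<sigma> - 1)) / \<sigma>) (at x)"
      using 2 by (intro DERIV_cdivide has_real_derivative_powr)
    then have "(kernel_primitive \<sigma> d has_real_derivative (\<sigma> * x powr (\<sigma> - 1)) / \<sigma>) (at x)"
      by (rule has_field_derivative_transform_within_open[where S="{0<..<d}"])
         (use 2 assms in \<open>auto simp: kernel_primitive_def max_def min_def\<close>)
    then show ?thesis using 2 assms by (simp add: kernel_majorant_def)
  next
    case 3
    have "((\<lambda>x. d powr \<sigma> / \<sigma> + d * (d powr (\<sigma> - 1) - x powr (\<sigma> - 1)) / (1 - \<sigma>))
             has_real_derivative 0 + d * (0 - (\<sigma> - 1) * x powr (\<sigma> - 1 - 1)) / (1 - \<sigma>)) (at x)"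
      using 3 assms
      by (intro DERIV_cdivide has_real_derivative_powr DERIV_add DERIV_const DERIV_cmult DERIV_diff) auto
    then have "(kernel_primitive \<sigma> d has_real_derivative 0 + d * (0 - (\<sigma> - 1) * x powr (\<sigma> - 1 - 1)) / (1 - \<sigma>)) (at x)"
      by (rule has_field_derivative_transform_within_open[where S="{d<..}"])
         (use 3 assms in \<open>auto simp: kernel_primitive_def max_def min_def\<close>)
    moreover have "0 + d * (0 - (\<sigma> - 1) * x powr (\<sigma> - 1 - 1)) / (1 - \<sigma>) = d * x powr (\<sigma> - 2)"
      using assms by (simp add: field_simps)
    ultimately show ?thesis using 3 assms by (simp add: kernel_majorant_def)
  qed
qed

text \<open>The bound is uniform in the position \<open>p\<close> of the singularity, which may lie
  outside the interval. The two sides of \<open>p\<close> give the factor 2, the change of scale the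
  factor \<open>1 / c\<close>.\<close>

lemma kernel_majorant_integral:
  assumes "0 < \<sigma>" "\<sigma> < 1" "0 < d" "0 < c"
  obtains I where "((\<lambda>t. kernel_majorant \<sigma> d (c * (t - p)) + kernel_majorant \<sigma> d (c * (p - t))) has_integral I) {0..1}"
    "I \<le> 2 / c * (1 / \<sigma> + 1 / (1 - \<sigma>)) * d powr \<sigma>"
proof -
  define P where "P = (\<lambda>t. (kernel_primitive \<sigma> d (c * (t - p)) - kernel_primitive \<sigma> d (c * (p - t))) / c)"
  have "((\<lambda>t. kernel_majorant \<sigma> d (c * (t - p)) + kernel_majorant \<sigma> d (c * (p - t))) has_integral P 1 - P 0) {0..1}"
  \<comment> \<open>The derivative is computed away from the three points where an argument equals 0
    or \<open>d\<close>; at these, continuity of \<open>P\<close> suffices.\<close>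
  proof (rule fundamental_theorem_of_calculus_strong[where S="{p, p + d / c, p - d / c}"])
    fix t assume "t \<in> {0..1} - {p, p + d / c, p - d / c}"
    then have t: "c * (t - p) \<noteq> 0" "c * (t - p) \<noteq> d" "c * (p - t) \<noteq> 0" "c * (p - t) \<noteq> d"
      using assms by (auto simp: field_simps)
    have 1: "((\<lambda>t. kernel_primitive \<sigma> d (c * (t - p))) has_real_derivative kernel_majorant \<sigma> d (c * (t - p)) * c) (at t)"
      by (rule DERIV_chain2[OF DERIV_kernel_primitive]) (use assms t in \<open>auto intro!: derivative_eq_intros\<close>)
    have 2: "((\<lambda>t. kernel_primitive \<sigma> d (c * (p - t))) has_real_derivative kernel_majorant \<sigma> d (c * (p - t)) * (-c)) (at t)"
      by (rule DERIV_chain2[OF DERIV_kernel_primitive]) (use assms t in \<open>auto intro!: derivative_eq_intros\<close>)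
    have "(P has_real_derivative (kernel_majorant \<sigma> d (c * (t - p)) * c - kernel_majorant \<sigma> d (c * (p - t)) * (-c)) / c) (at t)"
      unfolding P_def by (intro DERIV_cdivide DERIV_diff 1 2)
    then show "(P has_vector_derivative kernel_majorant \<sigma> d (c * (t - p)) + kernel_majorant \<sigma> d (c * (p - t))) (at t)"
      using assms by (simp add: has_real_derivative_iff_has_vector_derivative[symmetric] add_divide_distrib)
  next
    show "continuous_on {0..1} P"
      unfolding P_def using assms by (intro continuous_intros continuous_on_kernel_primitive) auto
  qed auto
  moreover have "P 1 - P 0 \<le> 2 / c * (1 / \<sigma> + 1 / (1 - \<sigma>)) * d powr \<sigma>"
  proof -
    have "P 1 - P 0 \<le> (2 * ((1 / \<sigma> + 1 / (1 - \<sigma>)) * d powr \<sigma>)) / c"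
      unfolding P_def diff_divide_distrib[symmetric] using assms kernel_primitive_bounds[OF assms(1-3)]
      by (intro divide_right_mono) (smt (verit), simp)
    then show ?thesis by (simp add: field_simps)
  qed
  ultimately show thesis by (rule that)
qed

subsection \<open>Difference quotient integrals\<close>

context regular_jordan_curve begin

text \<open>One constant \<open>C\<close> has to serve all points \<open>a\<close>, scales
  \<open>d\<close> and integrands \<open>q\<close>, so the uniform estimate is kept as a predicate
  of \<open>C\<close>. The hypothesis forces \<open>q t = 0\<close> where
  \<open>\<gamma> t = a\<close>; difference quotients comply because their numerator vanishes there
  and division by zero gives 0.\<close>

definition singular_bound :: "real \<Rightarrow> real \<Rightarrow> bool" where
  "singular_bound \<sigma> C \<longleftrightarrow> 0 \<le> C \<and>
     (\<forall>a d B (q :: real \<Rightarrow> complex). a \<in> path_image \<gamma> \<longrightarrow> 0 < d \<longrightarrow> 0 \<le> B \<longrightarrow> q \<in> borel_measurable borel \<longrightarrow>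
       (\<forall>t. norm (q t) \<le> B * (norm (\<gamma> t - a) powr (\<sigma> - 1) * d / (norm (\<gamma> t - a) + d))) \<longrightarrow>
       q integrable_on {0..1} \<and> norm (integral {0..1} q) \<le> B * C * d powr \<sigma>)"

lemma singular_boundD:
  assumes "singular_bound \<sigma> C" "a \<in> path_image \<gamma>" "0 < d" "0 \<le> B" "(q :: real \<Rightarrow> complex) \<in> borel_measurable borel"
    "\<And>t. norm (q t) \<le> B * (norm (\<gamma> t - a) powr (\<sigma> - 1) * d / (norm (\<gamma> t - a) + d))"
  shows "q integrable_on {0..1}" "norm (integral {0..1} q) \<le> B * C * d powr \<sigma>"
  using assms unfolding singular_bound_def by auto

text \<open>By the chord-arc bound the kernel is dominated by the majorant at the parameter
  distance, provided that the parameter \<open>p\<close> of \<open>a\<close> is within 1/2 of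
  \<open>t\<close>. For \<open>t\<close> in [0, 1] one of \<open>s - 1\<close>, \<open>s\<close>,
  \<open>s + 1\<close> is; summing over all three gives an integrable dominating function and the
  factor 3 in \<open>C\<close>.\<close>

lemma singular_bound_exists:
  assumes \<sigma>: "0 < \<sigma>" "\<sigma> < 1"
  obtains C where "singular_bound \<sigma> C"
proof -
  obtain c where c: "0 < c" "\<And>s t. \<bar>t - s\<bar> \<le> 1/2 \<Longrightarrow> c * \<bar>t - s\<bar> \<le> norm (\<gamma> t - \<gamma> s)"
    using chord_arc by blast
  define Q where "Q = 2 / c * (1 / \<sigma> + 1 / (1 - \<sigma>))"
  define C where "C = 3 * Q"
  have C: "0 \<le> C" using c \<sigma> by (auto simp: C_def Q_def)
  show thesis
  proof (rule that[of C], unfold singular_bound_def, intro conjI[OF C] allI impI conjI)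
    fix a d B and q :: "real \<Rightarrow> complex"
    assume a: "a \<in> path_image \<gamma>" and d: "0 < d" and B: "0 \<le> B" and q: "q \<in> borel_measurable borel"
      and q_le: "\<forall>t. norm (q t) \<le> B * (norm (\<gamma> t - a) powr (\<sigma> - 1) * d / (norm (\<gamma> t - a) + d))"
    obtain s where s: "a = \<gamma> s" "0 \<le> s" "s \<le> 1" using a by (auto simp: path_image_def)
    define k where "k = (\<lambda>p t. kernel_majorant \<sigma> d (c * (t - p)) + kernel_majorant \<sigma> d (c * (p - t)))"
    have k_nonneg: "0 \<le> k p t" for p t using kernel_majorant_nonneg[OF d] by (simp add: k_def)
    have "\<exists>I. (k p has_integral I) {0..1} \<and> I \<le> Q * d powr \<sigma>" for p
      unfolding k_def Q_def using kernel_majorant_integral[OF \<sigma> d c(1)] by metis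
    then obtain I where I: "\<And>p. (k p has_integral I p) {0..1}" "\<And>p. I p \<le> Q * d powr \<sigma>"
      by metis
    have le: "norm (\<gamma> t - a) powr (\<sigma> - 1) * d / (norm (\<gamma> t - a) + d) \<le> k p t"
      if p: "\<gamma> p = a" "\<bar>t - p\<bar> \<le> 1/2" for p t
    proof (cases "t = p")
      \<comment> \<open>Here the left side is 0, since
        \<open>0 powr (\<sigma> - 1) = 0\<close>.\<close>
      case True
      then show ?thesis using p k_nonneg by simp
    next
      case False
      then have v: "0 < c * \<bar>t - p\<bar>" using c by simp
      have "norm (\<gamma> t - a) powr (\<sigma> - 1) * d / (norm (\<gamma> t - a) + d) \<le> kernel_majorant \<sigma> d (c * \<bar>t - p\<bar>)"
        by (rule kernel_le_majorant[OF \<sigma>(2) d v]) (use c p in auto)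
      also have "\<dots> \<le> k p t"
        using kernel_majorant_nonneg[OF d] by (cases "t < p") (auto simp: k_def)
      finally show ?thesis .
    qed
    define G where "G = (\<lambda>t. B * (k (s - 1) t + k s t + k (s + 1) t))"
    have q_G: "norm (q t) \<le> G t" if t: "t \<in> {0..1}" for t
    proof -
      have "\<exists>p\<in>{s - 1, s, s + 1}. \<gamma> p = a \<and> \<bar>t - p\<bar> \<le> 1/2"
      proof -
        consider "\<bar>t - s\<bar> \<le> 1/2" | "t - s > 1/2" | "s - t > 1/2" by linarith
        then show ?thesis
        proof cases
          case 2
          then show ?thesis using s t periodic[of s] by (intro bexI[of _ "s + 1"]) auto
        next
          case 3
          then show ?thesis using s t periodic[of "s - 1"] by (intro bexI[of _ "s - 1"]) auto
        qed (use s in auto)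
      qed
      then have "norm (\<gamma> t - a) powr (\<sigma> - 1) * d / (norm (\<gamma> t - a) + d) \<le> k (s - 1) t + k s t + k (s + 1) t"
        using le[of "s - 1" t] le[of s t] le[of "s + 1" t] k_nonneg[of "s - 1" t] k_nonneg[of s t] k_nonneg[of "s + 1" t]
        by auto
      then show ?thesis unfolding G_def using q_le[rule_format, of t] B by (meson mult_left_mono order_trans)
    qed
    have G_int: "(G has_integral B * (I (s - 1) + I s + I (s + 1))) {0..1}"
      unfolding G_def by (intro has_integral_mult_right has_integral_add I(1))
    have qm: "q \<in> borel_measurable (lebesgue_on {0..1})"
      using q by (simp add: measurable_restrict_space1 measurable_completion)
    have "q integrable_on {0..1}"
      by (rule measurable_bounded_by_integrable_imp_integrable[OF qm has_integral_integrable[OF G_int] q_G]) auto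
    moreover have "norm (integral {0..1} q) \<le> B * (I (s - 1) + I s + I (s + 1))"
      by (rule integral_norm_bound_integral'[OF q_G qm _ G_int]) auto
    moreover have "B * (I (s - 1) + I s + I (s + 1)) \<le> B * (C * d powr \<sigma>)"
      using I(2)[of "s - 1"] I(2)[of s] I(2)[of "s + 1"] unfolding C_def
      by (intro mult_left_mono[OF _ B]) simp
    ultimately show "q integrable_on {0..1}" "norm (integral {0..1} q) \<le> B * C * d powr \<sigma>"
      by (simp_all add: mult.assoc)
  qed
qed

end

section \<open>Hoelder densities and their difference quotients\<close>

lemma holder_on_imp_continuous_on:
  assumes "holder_on \<sigma> S f" "0 < \<sigma>"
  shows "continuous_on S f"
proof -
  obtain M where M: "\<And>x y. x \<in> S \<Longrightarrow> y \<in> S \<Longrightarrow> norm (f x - f y) \<le> M * dist x y powr \<sigma>"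
    using assms unfolding holder_on_def by blast
  show ?thesis unfolding continuous_on_def
  proof
    fix x assume x: "x \<in> S"
    have "((\<lambda>y. M * dist y x powr \<sigma>) \<longlongrightarrow> M * dist x x powr \<sigma>) (at x within S)"
      using assms by (intro tendsto_intros tendsto_powr') (auto intro: eventuallyI)
    then have "((\<lambda>y. M * dist y x powr \<sigma>) \<longlongrightarrow> 0) (at x within S)" using assms by simp
    moreover have "\<forall>\<^sub>F y in at x within S. norm (f y - f x) \<le> M * dist y x powr \<sigma>"
      using M x by (auto simp: eventually_at_filter)
    ultimately have "((\<lambda>y. f y - f x) \<longlongrightarrow> 0) (at x within S)"
      by (rule Lim_null_comparison[rotated])
    then show "(f \<longlongrightarrow> f x) (at x within S)" by (rule LIM_zero_cancel)
  qed
qed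

locale holder_density = regular_jordan_curve +
  fixes F :: "complex \<Rightarrow> complex" and \<sigma> M :: real
  assumes \<sigma>: "0 < \<sigma>" "\<sigma> < 1" and M: "0 \<le> M"
    and holder: "\<And>x y. x \<in> path_image \<gamma> \<Longrightarrow> y \<in> path_image \<gamma> \<Longrightarrow> norm (F x - F y) \<le> M * norm (x - y) powr \<sigma>"
    and winding_inside: "\<And>z. z \<in> inside (path_image \<gamma>) \<Longrightarrow> winding_number \<gamma> z = 1"
begin

lemma continuous_density: "continuous_on (path_image \<gamma>) F"
  using holder by (intro holder_on_imp_continuous_on[OF _ \<sigma>(1)]) (auto simp: holder_on_def dist_norm)

lemma continuous_density_curve: "continuous_on S (\<lambda>t. F (\<gamma> t))"
  by (rule continuous_on_compose2[OF continuous_density continuous_curve]) auto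

text \<open>Subtracting \<open>F a\<close> weakens the singularity at \<open>a\<close> to the order
  \<open>\<sigma> - 1\<close>, so for \<open>z = a\<close> on the curve an absolutely convergent
  integral takes the place of a principal value. The base point \<open>a\<close> is independent of
  \<open>z\<close>, which allows several \<open>z\<close> to be compared under the same
  subtraction.\<close>

definition cauchy_diff :: "complex \<Rightarrow> complex \<Rightarrow> complex" where
  "cauchy_diff z a = integral {0..1} (\<lambda>t. (F (\<gamma> t) - F a) / (\<gamma> t - z) * \<gamma>' t)"

lemma integrable_off_curve:
  assumes "z \<notin> path_image \<gamma>"
  shows "(\<lambda>t. (F (\<gamma> t) - b) / (\<gamma> t - z) * \<gamma>' t) integrable_on {0..1}"
proof (rule integrable_continuous_real)
  have "\<gamma> t - z \<noteq> 0" for t using assms curve_in[of t] by auto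
  then show "continuous_on {0..1} (\<lambda>t. (F (\<gamma> t) - b) / (\<gamma> t - z) * \<gamma>' t)"
    using cont_deriv
    by (intro continuous_intros continuous_density_curve continuous_curve) (auto intro: continuous_on_subset)
qed

text \<open>For \<open>z\<close> on the curve the integrand need not be continuous, but division is
  Borel measurable everywhere; domination then yields integrability.\<close>

lemma density_measurable: "(\<lambda>t. (F (\<gamma> t) - b) / (\<gamma> t - z) * \<gamma>' t) \<in> borel_measurable borel"
  using cont_deriv continuous_density_curve[of UNIV] continuous_curve[of UNIV]
  by (intro borel_measurable_times borel_measurable_divide borel_measurable_diff borel_measurable_const
        borel_measurable_continuous_onI)

lemma integrable_on_curve:
  assumes a: "a \<in> path_image \<gamma>"
  shows "(\<lambda>t. (F (\<gamma> t) - F a) / (\<gamma> t - a) * \<gamma>' t) integrable_on {0..1}"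
proof -
  obtain L where L0: "0 \<le> L" and L: "\<And>t. norm (\<gamma>' t) \<le> L" using deriv_bounded by auto
  obtain C where C: "singular_bound \<sigma> C"
    using singular_bound_exists[OF \<sigma>] by blast
  obtain D where D: "0 < D" "\<And>x. x \<in> path_image \<gamma> \<Longrightarrow> norm (x - a) \<le> D"
    using bounded_translation_minus[OF bounded_simple_path_image[OF simple_path_curve], of a]
    unfolding bounded_pos by auto
  have "norm ((F (\<gamma> t) - F a) / (\<gamma> t - a) * \<gamma>' t)
     \<le> 2 * M * L * (norm (\<gamma> t - a) powr (\<sigma> - 1) * D / (norm (\<gamma> t - a) + D))" for t
  proof (cases "\<gamma> t = a")
    case False
    define u where "u = norm (\<gamma> t - a)"
    have u: "0 < u" "u \<le> D" using False D(2)[of "\<gamma> t"] by (auto simp: u_def)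
    have "norm ((F (\<gamma> t) - F a) / (\<gamma> t - a) * \<gamma>' t) \<le> (M * u powr \<sigma>) / u * L"
      unfolding norm_mult norm_divide u_def[symmetric] using L M u holder[OF curve_in a, of t]
      by (intro mult_mono divide_right_mono) (auto simp: u_def)
    also have "\<dots> = M * L * u powr (\<sigma> - 1) * 1" using u by (simp add: powr_diff)
    \<comment> \<open>All distances from \<open>a\<close> are at most \<open>D\<close>, so
      \<open>2 * D / (u + D)\<close> is at least 1 and the cut-off at scale \<open>D\<close> is
      inserted without loss.\<close>
    also have "\<dots> \<le> M * L * u powr (\<sigma> - 1) * (2 * D / (u + D))"
      using u D M L0 by (intro mult_left_mono) auto
    finally show ?thesis by (simp add: u_def mult_ac)
  qed simp
  from singular_boundD(1)[OF C a D(1) _ density_measurable this] M L0 show ?thesis by simp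
qed

text \<open>The approach is non-tangential: \<open>z\<close> is within \<open>d\<close> of
  \<open>a\<close>, yet its distance to the curve is comparable to \<open>d\<close>. The two kernels
  differ by \<open>(z - a) / ((\<zeta> - z) * (\<zeta> - a))\<close>, and
  \<open>norm (\<zeta> - z)\<close> is bounded below by a multiple of
  \<open>norm (\<zeta> - a) + d\<close>, which leaves the kernel of
  \<open>singular_bound\<close>.\<close>

lemma cauchy_diff_approach:
  assumes "0 \<le> K"
  obtains C where "0 \<le> C"
    "\<And>a z d. a \<in> path_image \<gamma> \<Longrightarrow> 0 < d \<Longrightarrow> norm (z - a) \<le> d \<Longrightarrow> (\<And>\<zeta>. \<zeta> \<in> path_image \<gamma> \<Longrightarrow> d \<le> K * norm (\<zeta> - z)) \<Longrightarrow>
       norm (cauchy_diff z a - cauchy_diff a a) \<le> C * d powr \<sigma>"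
proof -
  obtain L where L0: "0 \<le> L" and L: "\<And>t. norm (\<gamma>' t) \<le> L" using deriv_bounded by auto
  obtain C where C: "singular_bound \<sigma> C"
    using singular_bound_exists[OF \<sigma>] by blast
  have C0: "0 \<le> C" using C by (simp add: singular_bound_def)
  define B where "B = M * L * (1 + 2 * K)"
  have B: "0 \<le> B" using M L0 assms by (simp add: B_def)
  show thesis
  proof (rule that[of "B * C"])
    show "0 \<le> B * C" using B C0 by simp
    fix a z d assume a: "a \<in> path_image \<gamma>" and d: "0 < d" and za: "norm (z - a) \<le> d"
      and z: "\<And>\<zeta>. \<zeta> \<in> path_image \<gamma> \<Longrightarrow> d \<le> K * norm (\<zeta> - z)"
    have zn: "z \<notin> path_image \<gamma>" using z[of z] d by auto
    define q where "q = (\<lambda>t. (F (\<gamma> t) - F a) / (\<gamma> t - z) * \<gamma>' t - (F (\<gamma> t) - F a) / (\<gamma> t - a) * \<gamma>' t)"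
    have "norm (q t) \<le> B * (norm (\<gamma> t - a) powr (\<sigma> - 1) * d / (norm (\<gamma> t - a) + d))" for t
    proof (cases "\<gamma> t = a")
      case True
      then show ?thesis by (simp add: q_def)
    next
      case False
      define u where "u = norm (\<gamma> t - a)"
      define v where "v = norm (\<gamma> t - z)"
      have uv: "0 < u" "0 < v" using False zn curve_in[of t] by (auto simp: u_def v_def)
      have "u \<le> v + norm (z - a)" unfolding u_def v_def by norm
      \<comment> \<open>From \<open>u \<le> v + d\<close> and two uses of
        \<open>d \<le> K * v\<close>.\<close>
      then have "u + d \<le> (1 + 2 * K) * v" using za z[OF curve_in[of t]] by (simp add: v_def algebra_simps)
      then have 1: "1 / v \<le> (1 + 2 * K) / (u + d)" using uv d assms by (simp add: field_simps)
      have "q t = (F (\<gamma> t) - F a) * (z - a) / ((\<gamma> t - z) * (\<gamma> t - a)) * \<gamma>' t"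
        using uv unfolding q_def u_def v_def by (simp add: field_simps)
      then have "norm (q t) = norm (F (\<gamma> t) - F a) * norm (z - a) / (v * u) * norm (\<gamma>' t)"
        by (simp add: norm_mult norm_divide u_def v_def)
      also have "\<dots> \<le> (M * u powr \<sigma>) * d / (v * u) * L"
        using holder[OF curve_in a, of t] za uv L M d
        by (intro mult_mono divide_right_mono) (auto simp: u_def)
      also have "\<dots> = M * L * u powr (\<sigma> - 1) * d * (1 / v)" using uv by (simp add: powr_diff field_simps)
      also have "\<dots> \<le> M * L * u powr (\<sigma> - 1) * d * ((1 + 2 * K) / (u + d))"
        using M L0 d by (intro mult_left_mono[OF 1]) auto
      finally show ?thesis by (simp add: B_def u_def mult_ac)
    qed
    moreover have "q \<in> borel_measurable borel"
      unfolding q_def by (intro borel_measurable_diff density_measurable)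
    ultimately have "norm (integral {0..1} q) \<le> B * C * d powr \<sigma>" by (intro singular_boundD(2)[OF C a d B]) auto
    then show "norm (cauchy_diff z a - cauchy_diff a a) \<le> B * C * d powr \<sigma>"
      unfolding q_def cauchy_diff_def
      by (subst (asm) integral_diff[OF integrable_off_curve[OF zn] integrable_on_curve[OF a]])
  qed
qed

text \<open>Both points share the base point \<open>a\<close>, nearest to \<open>z\<close>. With
  \<open>d = norm (z - a)\<close> and \<open>\<delta> = norm (z - w) \<le> d / 2\<close>, both stay
  away from the curve on the scale \<open>d\<close>. The difference is then of order
  \<open>\<delta> * d powr (\<sigma> - 1)\<close>, which is at most
  \<open>\<delta> powr \<sigma>\<close> because \<open>\<sigma> - 1\<close> is negative.\<close>

lemma cauchy_diff_interior:
  obtains C where "0 \<le> C"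
    "\<And>a z w. a \<in> path_image \<gamma> \<Longrightarrow> z \<notin> path_image \<gamma> \<Longrightarrow> (\<And>\<zeta>. \<zeta> \<in> path_image \<gamma> \<Longrightarrow> norm (z - a) \<le> norm (\<zeta> - z)) \<Longrightarrow>
       norm (z - w) \<le> norm (z - a) / 2 \<Longrightarrow> norm (cauchy_diff z a - cauchy_diff w a) \<le> C * norm (z - w) powr \<sigma>"
proof -
  obtain L where L0: "0 \<le> L" and L: "\<And>t. norm (\<gamma>' t) \<le> L" using deriv_bounded by auto
  obtain C where C: "singular_bound \<sigma> C"
    using singular_bound_exists[OF \<sigma>] by blast
  have C0: "0 \<le> C" using C by (simp add: singular_bound_def)
  show thesis
  proof (rule that[of "18 * M * L * C"])
    show "0 \<le> 18 * M * L * C" using M L0 C0 by simp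
    fix a z w assume a: "a \<in> path_image \<gamma>" and zn: "z \<notin> path_image \<gamma>"
      and z: "\<And>\<zeta>. \<zeta> \<in> path_image \<gamma> \<Longrightarrow> norm (z - a) \<le> norm (\<zeta> - z)"
      and zw: "norm (z - w) \<le> norm (z - a) / 2"
    define d where "d = norm (z - a)"
    define \<delta> where "\<delta> = norm (z - w)"
    have d: "0 < d" using zn a by (auto simp: d_def)
    have \<delta>: "0 \<le> \<delta>" "\<delta> \<le> d / 2" using zw by (auto simp: d_def \<delta>_def)
    have wn: "w \<notin> path_image \<gamma>"
    proof
      assume "w \<in> path_image \<gamma>"
      then have "d \<le> \<delta>" using z by (simp add: d_def \<delta>_def norm_minus_commute)
      then show False using d \<delta> by linarith
    qed
    \<comment> \<open>The kernels differ by a multiple of \<delta>, while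
      \<open>singular_bound\<close> carries a factor \<open>d\<close>; the quotient
      \<open>\<delta> / d\<close> adjusts this. The number 18 is the product of the constants 3 and
      6 below.\<close>
    define B where "B = 18 * M * L * (\<delta> / d)"
    have B: "0 \<le> B" using M L0 d \<delta> by (simp add: B_def)
    define q where "q = (\<lambda>t. (F (\<gamma> t) - F a) / (\<gamma> t - z) * \<gamma>' t - (F (\<gamma> t) - F a) / (\<gamma> t - w) * \<gamma>' t)"
    have "norm (q t) \<le> B * (norm (\<gamma> t - a) powr (\<sigma> - 1) * d / (norm (\<gamma> t - a) + d))" for t
    proof (cases "\<gamma> t = a")
      case True
      then show ?thesis by (simp add: q_def)
    next
      case False
      define u where "u = norm (\<gamma> t - a)"
      define v where "v = norm (\<gamma> t - z)"
      define v' where "v' = norm (\<gamma> t - w)"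
      have uv: "0 < u" "0 < v" "0 < v'" using False zn wn curve_in[of t] by (auto simp: u_def v_def v'_def)
      have "u \<le> v + d" unfolding u_def v_def d_def by norm
      moreover have dv: "d \<le> v" using z[OF curve_in[of t]] by (simp add: d_def v_def)
      ultimately have 1: "u + d \<le> 3 * v" by simp
      have "v \<le> v' + \<delta>" unfolding v_def v'_def \<delta>_def by norm
      \<comment> \<open>As \<open>\<delta> \<le> d / 2 \<le> v / 2\<close>, the preceding inequality
        gives \<open>v \<le> 2 * v'\<close>.\<close>
      then have 2: "u + d \<le> 6 * v'" using dv \<delta> 1 by linarith
      have "(u + d) * u \<le> (u + d) * (u + d)" using d uv by (intro mult_left_mono) auto
      also have "\<dots> \<le> (3 * v) * (6 * v')" using d uv by (intro mult_mono 1 2) auto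
      finally have "(u + d) * u \<le> 18 * (v * v')" by simp
      then have 3: "1 / (v * v') \<le> 18 / ((u + d) * u)" using uv d by (subst frac_le_eq) (auto simp: divide_simps)
      have "q t = (F (\<gamma> t) - F a) * (z - w) / ((\<gamma> t - z) * (\<gamma> t - w)) * \<gamma>' t"
        using uv unfolding q_def v_def v'_def by (simp add: field_simps)
      then have "norm (q t) = norm (F (\<gamma> t) - F a) * \<delta> * (1 / (v * v')) * norm (\<gamma>' t)"
        by (simp add: norm_mult norm_divide v'_def v_def \<delta>_def)
      also have "\<dots> \<le> (M * u powr \<sigma>) * \<delta> * (18 / ((u + d) * u)) * L"
        using holder[OF curve_in a, of t] uv L M d \<delta>
        by (intro mult_mono 3) (auto simp: u_def)
      also have "\<dots> = B * (u powr (\<sigma> - 1) * d / (u + d))"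
      proof -
        define e where "e = u + d"
        have "0 < e" using uv d by (simp add: e_def)
        then show ?thesis using uv d unfolding e_def[symmetric] by (simp add: B_def powr_diff field_simps)
      qed
      finally show ?thesis by (simp add: u_def)
    qed
    moreover have "q \<in> borel_measurable borel"
      unfolding q_def by (intro borel_measurable_diff density_measurable)
    ultimately have "norm (integral {0..1} q) \<le> B * C * d powr \<sigma>" by (intro singular_boundD(2)[OF C a d B]) auto
    also have "\<dots> \<le> 18 * M * L * C * \<delta> powr \<sigma>"
    proof (cases "\<delta> = 0")
      case False
      have "\<delta> * d powr (\<sigma> - 1) \<le> \<delta> * \<delta> powr (\<sigma> - 1)"
        using \<delta> \<sigma> False d by (intro mult_left_mono powr_mono2') auto
      also have "\<dots> = \<delta> powr \<sigma>" using \<delta> by (simp add: powr_mult_base)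
      finally have "18 * M * L * C * (\<delta> * d powr (\<sigma> - 1)) \<le> 18 * M * L * C * \<delta> powr \<sigma>"
        using M L0 C0 by (intro mult_left_mono) auto
      then show ?thesis using d by (simp add: B_def powr_diff field_simps)
    qed (simp add: B_def)
    finally show "norm (cauchy_diff z a - cauchy_diff w a) \<le> 18 * M * L * C * norm (z - w) powr \<sigma>"
      unfolding q_def cauchy_diff_def \<delta>_def
      by (subst (asm) integral_diff[OF integrable_off_curve[OF zn] integrable_off_curve[OF wn]])
  qed
qed

end

subsection \<open>Boundary values of the Cauchy integral\<close>

context holder_density begin

lemma norm_winding_le: "z \<notin> path_image \<gamma> \<Longrightarrow> norm (winding_number \<gamma> z) \<le> 1"
  using winding_inside[of z] winding_outside[of z] jordan(5) by fastforce

text \<open>The constant \<open>F a\<close> integrates to a winding number. The point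
  \<open>a\<close> is arbitrary, so one value of the Cauchy integral can be written with different
  base points.\<close>

lemma cauchy_int_eq:
  assumes "z \<notin> path_image \<gamma>"
  shows "cauchy_int \<gamma> F z = cauchy_diff z a / (2 * pi * \<i>) + F a * winding_number \<gamma> z"
proof -
  have nz: "\<gamma> t - z \<noteq> 0" for t using assms curve_in[of t] by auto
  have int1: "(\<lambda>t. 1 / (\<gamma> t - z) * \<gamma>' t) integrable_on {0..1}"
    using cont_deriv nz
    by (intro integrable_continuous_real continuous_intros continuous_curve) (auto intro: continuous_on_subset)
  have "contour_integral \<gamma> (\<lambda>\<zeta>. F \<zeta> / (\<zeta> - z)) =
      integral {0..1} (\<lambda>t. (F (\<gamma> t) - F a) / (\<gamma> t - z) * \<gamma>' t + F a * (1 / (\<gamma> t - z) * \<gamma>' t))"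
    unfolding contour_integral_integral by (intro integral_cong) (simp add: diff_divide_distrib left_diff_distrib)
  also have "\<dots> = cauchy_diff z a + F a * contour_integral \<gamma> (\<lambda>\<zeta>. 1 / (\<zeta> - z))"
    unfolding cauchy_diff_def contour_integral_integral vector_derivative_curve
    by (subst integral_add[OF integrable_off_curve[OF assms] integrable_on_mult_right[OF int1]])
       (simp only: integral_mult_right)
  finally show ?thesis
    unfolding cauchy_int_def winding_number_valid_path[OF valid_path_curve assms] by (simp add: add_divide_distrib)
qed

lemma cauchy_diff_change:
  assumes "z \<notin> path_image \<gamma>"
  shows "cauchy_diff z a - cauchy_diff z b = (F b - F a) * winding_number \<gamma> z * (2 * pi * \<i>)"
  using cauchy_int_eq[OF assms, of a] cauchy_int_eq[OF assms, of b] by (simp add: field_simps)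

text \<open>Two points of the curve at distance \<open>\<epsilon>\<close> are compared through a corkscrew point for that scale;
  on which side of the curve it lies is irrelevant, since the error is a multiple of the increment of \<open>F\<close>.\<close>

lemma cauchy_diff_holder:
  obtains C where "0 \<le> C"
    "\<forall>a\<in>path_image \<gamma>. \<forall>b\<in>path_image \<gamma>. norm (cauchy_diff a a - cauchy_diff b b) \<le> C * norm (a - b) powr \<sigma>"
proof -
  obtain D where D: "\<And>x. x \<in> path_image \<gamma> \<Longrightarrow> norm x \<le> D"
    using bounded_simple_path_image[OF simple_path_curve] unfolding bounded_iff by auto
  obtain K where K: "1 \<le> K" "\<forall>a\<in>path_image \<gamma>. \<forall>\<epsilon>>0. \<epsilon> \<le> 2 * D \<longrightarrow>
       (\<exists>z. norm (z - a) \<le> K * \<epsilon> \<and> (\<forall>\<zeta>\<in>path_image \<gamma>. \<epsilon> \<le> K * norm (\<zeta> - z)))"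
    using corkscrew[of "2 * D"] by metis
  \<comment> \<open>The separation constant is \<open>(K + 1) * K\<close>: the corkscrew point for
    the scale \<epsilon> lies within \<open>(K + 1) * \<epsilon>\<close> of both \<open>a\<close>
    and \<open>b\<close>, and \<open>\<epsilon> \<le> K * norm (\<zeta> - z)\<close> gets multiplied
    by \<open>K + 1\<close>.\<close>
  obtain C where C: "0 \<le> C" "\<And>a z d. a \<in> path_image \<gamma> \<Longrightarrow> 0 < d \<Longrightarrow> norm (z - a) \<le> d \<Longrightarrow>
       (\<And>\<zeta>. \<zeta> \<in> path_image \<gamma> \<Longrightarrow> d \<le> ((K + 1) * K) * norm (\<zeta> - z)) \<Longrightarrow>
       norm (cauchy_diff z a - cauchy_diff a a) \<le> C * d powr \<sigma>"
    using cauchy_diff_approach[of "(K + 1) * K"] K(1) by auto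
  define C' where "C' = 2 * (C * (K + 1) powr \<sigma>) + M * (2 * pi)"
  have C': "0 \<le> C'" using C M by (simp add: C'_def)
  have "norm (cauchy_diff a a - cauchy_diff b b) \<le> C' * norm (a - b) powr \<sigma>"
    if a: "a \<in> path_image \<gamma>" and b: "b \<in> path_image \<gamma>" for a b
  proof (cases "a = b")
    case False
    define \<epsilon> where "\<epsilon> = norm (a - b)"
    have \<epsilon>: "0 < \<epsilon>" "\<epsilon> \<le> 2 * D"
      using False norm_triangle_ineq4[of a b] D[OF a] D[OF b] by (auto simp: \<epsilon>_def)
    obtain z where z: "norm (z - a) \<le> K * \<epsilon>" "\<And>\<zeta>. \<zeta> \<in> path_image \<gamma> \<Longrightarrow> \<epsilon> \<le> K * norm (\<zeta> - z)"
      using K(2) a \<epsilon> by blast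
    have zn: "z \<notin> path_image \<gamma>" using z(2)[of z] \<epsilon> by auto
    have za: "norm (z - a) \<le> (K + 1) * \<epsilon>" using z(1) \<epsilon> by (simp add: algebra_simps)
    have "norm (z - b) \<le> norm (z - a) + \<epsilon>" unfolding \<epsilon>_def by norm
    then have zb: "norm (z - b) \<le> (K + 1) * \<epsilon>" using z(1) by (simp add: algebra_simps)
    have sep: "(K + 1) * \<epsilon> \<le> ((K + 1) * K) * norm (\<zeta> - z)" if "\<zeta> \<in> path_image \<gamma>" for \<zeta>
      using z(2)[OF that] K(1) by (simp add: mult.assoc)
    have pos: "0 < (K + 1) * \<epsilon>" using K(1) \<epsilon> by simp
    have e: "((K + 1) * \<epsilon>) powr \<sigma> = (K + 1) powr \<sigma> * \<epsilon> powr \<sigma>" using K(1) \<epsilon> by (simp add: powr_mult)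
    have 1: "norm (cauchy_diff z a - cauchy_diff a a) \<le> C * ((K + 1) powr \<sigma> * \<epsilon> powr \<sigma>)"
      using C(2)[OF a pos za sep] by (simp only: e)
    have 2: "norm (cauchy_diff z b - cauchy_diff b b) \<le> C * ((K + 1) powr \<sigma> * \<epsilon> powr \<sigma>)"
      using C(2)[OF b pos zb sep] by (simp only: e)
    have "norm (cauchy_diff z a - cauchy_diff z b) = norm (F b - F a) * norm (winding_number \<gamma> z) * (2 * pi)"
      unfolding cauchy_diff_change[OF zn] by (simp add: norm_mult)
    also have "\<dots> \<le> (M * \<epsilon> powr \<sigma>) * 1 * (2 * pi)"
      using holder[OF b a] norm_winding_le[OF zn] M
      by (intro mult_mono) (auto simp: \<epsilon>_def norm_minus_commute)
    finally have 3: "norm (cauchy_diff z a - cauchy_diff z b) \<le> M * (2 * pi) * \<epsilon> powr \<sigma>" by (simp add: mult_ac)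
    have "norm (cauchy_diff a a - cauchy_diff b b) \<le>
        norm (cauchy_diff z a - cauchy_diff a a) + norm (cauchy_diff z b - cauchy_diff b b) + norm (cauchy_diff z a - cauchy_diff z b)"
      by norm
    also have "\<dots> \<le> C' * \<epsilon> powr \<sigma>" using 1 2 3 by (simp add: C'_def algebra_simps)
    finally show ?thesis by (simp add: \<epsilon>_def)
  qed simp
  then show thesis using that[OF C'] by blast
qed

text \<open>Here \<open>n\<close> is the winding number on the side of the curve from which boundary values are taken.\<close>

definition cauchy_ext :: "complex \<Rightarrow> complex \<Rightarrow> complex" where
  "cauchy_ext n z = (if z \<in> path_image \<gamma> then n * F z + cauchy_diff z z / (2 * pi * \<i>) else cauchy_int \<gamma> F z)"

lemma nearest_point:
  obtains a where "a \<in> path_image \<gamma>" "\<And>\<zeta>. \<zeta> \<in> path_image \<gamma> \<Longrightarrow> norm (z - a) \<le> norm (\<zeta> - z)"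
    "z \<in> path_image \<gamma> \<Longrightarrow> a = z"
proof -
  have "path_image \<gamma> \<noteq> {}" by simp
  then obtain a where a: "a \<in> path_image \<gamma>" "\<And>y. y \<in> path_image \<gamma> \<Longrightarrow> dist z a \<le> dist z y"
    using distance_attains_inf[OF closed_simple_path_image[OF simple_path_curve], of z] by blast
  then have "norm (z - a) \<le> norm (\<zeta> - z)" if "\<zeta> \<in> path_image \<gamma>" for \<zeta>
    using that by (metis dist_norm norm_minus_commute)
  then show thesis using that[of a] a by fastforce
qed

text \<open>A set \<Omega> of constant winding number stands for either side of the curve. If
  \<open>norm (z - w)\<close> is at most half the distance of one point to the curve, the two values
  are compared directly with a common base point. Otherwise both points are within
  \<open>2 * norm (z - w)\<close> of their nearest points on the curve, and the comparison runs
  through these.\<close>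

lemma holder_on_cauchy_ext:
  assumes \<Omega>: "\<And>z. z \<in> \<Omega> \<Longrightarrow> z \<notin> path_image \<gamma> \<and> winding_number \<gamma> z = n" and n: "norm n \<le> 1"
  shows "holder_on \<sigma> (\<Omega> \<union> path_image \<gamma>) (cauchy_ext n)"
proof -
  obtain C1 where C1: "0 \<le> C1" "\<And>a z d. a \<in> path_image \<gamma> \<Longrightarrow> 0 < d \<Longrightarrow> norm (z - a) \<le> d \<Longrightarrow>
       (\<And>\<zeta>. \<zeta> \<in> path_image \<gamma> \<Longrightarrow> d \<le> 1 * norm (\<zeta> - z)) \<Longrightarrow>
       norm (cauchy_diff z a - cauchy_diff a a) \<le> C1 * d powr \<sigma>"
    using cauchy_diff_approach[of 1] by auto
  obtain C2 where C2: "0 \<le> C2" "\<forall>a\<in>path_image \<gamma>. \<forall>b\<in>path_image \<gamma>. norm (cauchy_diff a a - cauchy_diff b b) \<le> C2 * norm (a - b) powr \<sigma>"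
    using cauchy_diff_holder by blast
  obtain C3 where C3: "0 \<le> C3" "\<And>a z w. a \<in> path_image \<gamma> \<Longrightarrow> z \<notin> path_image \<gamma> \<Longrightarrow> (\<And>\<zeta>. \<zeta> \<in> path_image \<gamma> \<Longrightarrow> norm (z - a) \<le> norm (\<zeta> - z)) \<Longrightarrow>
       norm (z - w) \<le> norm (z - a) / 2 \<Longrightarrow> norm (cauchy_diff z a - cauchy_diff w a) \<le> C3 * norm (z - w) powr \<sigma>"
    using cauchy_diff_interior by metis
  have div_le: "norm (x / (2 * pi * \<i>)) \<le> norm x" for x :: complex
  proof -
    have "norm x / (2 * pi) \<le> norm x / 1" using pi_ge_two by (intro divide_left_mono) auto
    then show ?thesis by (simp add: norm_divide norm_mult)
  qed
  have boundary: "norm (cauchy_ext n a - cauchy_ext n b) \<le> (M + C2) * norm (a - b) powr \<sigma>"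
    if ab: "a \<in> path_image \<gamma>" "b \<in> path_image \<gamma>" for a b
  proof -
    have "cauchy_ext n a - cauchy_ext n b = n * (F a - F b) + (cauchy_diff a a - cauchy_diff b b) / (2 * pi * \<i>)"
      using ab by (simp add: cauchy_ext_def algebra_simps diff_divide_distrib)
    then have "norm (cauchy_ext n a - cauchy_ext n b) \<le> norm n * norm (F a - F b) + norm (cauchy_diff a a - cauchy_diff b b)"
      by (smt (verit) norm_triangle_ineq norm_mult div_le)
    also have "\<dots> \<le> 1 * (M * norm (a - b) powr \<sigma>) + C2 * norm (a - b) powr \<sigma>"
      using n holder[OF ab] C2(2) ab by (intro add_mono mult_mono) auto
    finally show ?thesis by (simp add: algebra_simps)
  qed
  have approach: "norm (cauchy_ext n z - cauchy_ext n a) \<le> C1 * norm (z - a) powr \<sigma>"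
    if z: "z \<in> \<Omega>" and a: "a \<in> path_image \<gamma>" "\<And>\<zeta>. \<zeta> \<in> path_image \<gamma> \<Longrightarrow> norm (z - a) \<le> norm (\<zeta> - z)" for z a
  proof -
    have zn: "z \<notin> path_image \<gamma>" "winding_number \<gamma> z = n" using \<Omega>[OF z] by auto
    \<comment> \<open>The term \<open>n * F a\<close> occurs in both values and cancels, because
      \<open>n\<close> is the winding number at \<open>z\<close>.\<close>
    have "cauchy_ext n z - cauchy_ext n a = (cauchy_diff z a - cauchy_diff a a) / (2 * pi * \<i>)"
      using a(1) zn cauchy_int_eq[OF zn(1), of a] by (simp add: cauchy_ext_def diff_divide_distrib)
    then have "norm (cauchy_ext n z - cauchy_ext n a) \<le> norm (cauchy_diff z a - cauchy_diff a a)"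
      using div_le by metis
    also have "\<dots> \<le> C1 * norm (z - a) powr \<sigma>"
      using a zn by (intro C1(2)) auto
    finally show ?thesis .
  qed
  have interior: "norm (cauchy_ext n z - cauchy_ext n w) \<le> C3 * norm (z - w) powr \<sigma>"
    if z: "z \<in> \<Omega>" and w: "w \<in> \<Omega>" and a: "a \<in> path_image \<gamma>" "\<And>\<zeta>. \<zeta> \<in> path_image \<gamma> \<Longrightarrow> norm (z - a) \<le> norm (\<zeta> - z)"
      and zw: "norm (z - w) \<le> norm (z - a) / 2" for z w a
  proof -
    have zn: "z \<notin> path_image \<gamma>" "winding_number \<gamma> z = n" "w \<notin> path_image \<gamma>" "winding_number \<gamma> w = n"
      using \<Omega>[OF z] \<Omega>[OF w] by auto
    have "cauchy_ext n z - cauchy_ext n w = (cauchy_diff z a - cauchy_diff w a) / (2 * pi * \<i>)"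
      using zn cauchy_int_eq[OF zn(1), of a] cauchy_int_eq[OF zn(3), of a]
      by (simp add: cauchy_ext_def diff_divide_distrib)
    then have "norm (cauchy_ext n z - cauchy_ext n w) \<le> norm (cauchy_diff z a - cauchy_diff w a)"
      using div_le by metis
    also have "\<dots> \<le> C3 * norm (z - w) powr \<sigma>"
      using a zn zw by (intro C3(2)) auto
    finally show ?thesis .
  qed
  define C where "C = C3 + (2 * (C1 * 2 powr \<sigma>) + (M + C2) * 5 powr \<sigma>)"
  have "norm (cauchy_ext n z - cauchy_ext n w) \<le> C * norm (z - w) powr \<sigma>"
    if z: "z \<in> \<Omega> \<union> path_image \<gamma>" and w: "w \<in> \<Omega> \<union> path_image \<gamma>" for z w
  proof -
    obtain a where a: "a \<in> path_image \<gamma>" "\<And>\<zeta>. \<zeta> \<in> path_image \<gamma> \<Longrightarrow> norm (z - a) \<le> norm (\<zeta> - z)" "z \<in> path_image \<gamma> \<Longrightarrow> a = z"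
      using nearest_point by blast
    obtain b where b: "b \<in> path_image \<gamma>" "\<And>\<zeta>. \<zeta> \<in> path_image \<gamma> \<Longrightarrow> norm (w - b) \<le> norm (\<zeta> - w)" "w \<in> path_image \<gamma> \<Longrightarrow> b = w"
      using nearest_point by blast
    define \<delta> where "\<delta> = norm (z - w)"
    have \<delta>: "0 \<le> \<delta>" by (simp add: \<delta>_def)
    have le1: "C3 * \<delta> powr \<sigma> \<le> C * \<delta> powr \<sigma>"
      using C1 C2 M by (intro mult_right_mono) (auto simp: C_def)
    have le2: "(2 * (C1 * 2 powr \<sigma>) + (M + C2) * 5 powr \<sigma>) * \<delta> powr \<sigma> \<le> C * \<delta> powr \<sigma>"
      using C3 by (intro mult_right_mono) (auto simp: C_def)
    consider "\<delta> = 0" | "0 < \<delta>" "\<delta> \<le> norm (z - a) / 2" | "0 < \<delta>" "\<delta> \<le> norm (w - b) / 2"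
      | "norm (z - a) < 2 * \<delta>" "norm (w - b) < 2 * \<delta>" using \<delta> by linarith
    then have "norm (cauchy_ext n z - cauchy_ext n w) \<le> C * \<delta> powr \<sigma>"
    proof cases
      case 1
      then show ?thesis by (simp add: \<delta>_def)
    next
      case 2
      have "\<delta> < norm (z - a)" using 2 by linarith
      \<comment> \<open>A point of the curve cannot be nearer to \<open>z\<close> than
        \<open>a\<close>, so both points lie in \<Omega>.\<close>
      then have "w \<notin> path_image \<gamma>" using a(2)[of w] unfolding \<delta>_def by (metis norm_minus_commute not_le)
      moreover have "z \<notin> path_image \<gamma>" using a(3) 2 by auto
      ultimately have "norm (cauchy_ext n z - cauchy_ext n w) \<le> C3 * \<delta> powr \<sigma>"
        using interior[OF _ _ a(1,2), of w] z w 2 by (auto simp: \<delta>_def)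
      then show ?thesis using le1 by simp
    next
      case 3
      have "\<delta> < norm (w - b)" using 3 by linarith
      then have "z \<notin> path_image \<gamma>" using b(2)[of z] unfolding \<delta>_def by (metis not_le)
      moreover have "w \<notin> path_image \<gamma>" using b(3) 3 by auto
      ultimately have "norm (cauchy_ext n z - cauchy_ext n w) \<le> C3 * \<delta> powr \<sigma>"
        using interior[OF _ _ b(1,2), of z] z w 3 by (auto simp: \<delta>_def norm_minus_commute)
      then show ?thesis using le1 by simp
    next
      case 4
      \<comment> \<open>If \<open>z\<close> is on the curve then \<open>a = z\<close> and the left
        side is 0.\<close>
      have za: "norm (cauchy_ext n z - cauchy_ext n a) \<le> C1 * norm (z - a) powr \<sigma>"
        using approach[of z a] a z C1(1) by (cases "z \<in> path_image \<gamma>") auto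
      have wb: "norm (cauchy_ext n w - cauchy_ext n b) \<le> C1 * norm (w - b) powr \<sigma>"
        using approach[of w b] b w C1(1) by (cases "w \<in> path_image \<gamma>") auto
      have "norm (a - b) \<le> norm (z - a) + norm (w - b) + \<delta>" unfolding \<delta>_def by norm
      then have ab: "norm (a - b) \<le> 5 * \<delta>" using 4 by linarith
      have p: "norm (z - a) powr \<sigma> \<le> 2 powr \<sigma> * \<delta> powr \<sigma>" "norm (w - b) powr \<sigma> \<le> 2 powr \<sigma> * \<delta> powr \<sigma>"
        "norm (a - b) powr \<sigma> \<le> 5 powr \<sigma> * \<delta> powr \<sigma>"
        using 4 ab \<sigma> \<delta> by (auto simp: powr_mult[symmetric] intro!: powr_mono2)
      have "norm (cauchy_ext n z - cauchy_ext n w) \<le>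
         norm (cauchy_ext n z - cauchy_ext n a) + norm (cauchy_ext n w - cauchy_ext n b) + norm (cauchy_ext n a - cauchy_ext n b)"
        by norm
      also have "\<dots> \<le> C1 * norm (z - a) powr \<sigma> + C1 * norm (w - b) powr \<sigma> + (M + C2) * norm (a - b) powr \<sigma>"
        by (intro add_mono za wb boundary a b)
      also have "\<dots> \<le> C1 * (2 powr \<sigma> * \<delta> powr \<sigma>) + C1 * (2 powr \<sigma> * \<delta> powr \<sigma>) + (M + C2) * (5 powr \<sigma> * \<delta> powr \<sigma>)"
        using C1(1) C2(1) M by (intro add_mono mult_left_mono p) auto
      also have "\<dots> = (2 * (C1 * 2 powr \<sigma>) + (M + C2) * 5 powr \<sigma>) * \<delta> powr \<sigma>" by (simp add: algebra_simps)
      finally show ?thesis using le2 by simp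
    qed
    then show ?thesis by (simp add: \<delta>_def)
  qed
  then show ?thesis unfolding holder_on_def dist_norm by blast
qed

section \<open>Holomorphy, decay and boundary values of the Cauchy integral\<close>

lemma cauchy_int_holomorphic: "cauchy_int \<gamma> F holomorphic_on - path_image \<gamma>"
proof -
  obtain L where L: "\<And>t. norm (\<gamma>' t) \<le> L" using deriv_bounded by auto
  \<comment> \<open>The exponent 1 is written out to match the general kernel
    \<open>1 / (u - w) ^ k\<close>, whose derivative in \<open>w\<close> raises \<open>k\<close> by
    one.\<close>
  have int: "((\<lambda>u. F u / (u - w) ^ 1) has_contour_integral contour_integral \<gamma> (\<lambda>\<zeta>. F \<zeta> / (\<zeta> - w))) \<gamma>"
    if "w \<in> UNIV - path_image \<gamma>" for w
  proof -
    have "(\<lambda>\<zeta>. F \<zeta> / (\<zeta> - w)) contour_integrable_on \<gamma>"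
      unfolding contour_integrable_on using integrable_off_curve[of w 0] that by simp
    then show ?thesis by (simp add: has_contour_integral_integral)
  qed
  have "((\<lambda>w. contour_integral \<gamma> (\<lambda>\<zeta>. F \<zeta> / (\<zeta> - w))) has_field_derivative
      of_nat 1 * contour_integral \<gamma> (\<lambda>u. F u / (u - w) ^ Suc 1)) (at w)" if "w \<notin> path_image \<gamma>" for w
    by (rule Cauchy_next_derivative(2)[OF continuous_density _ int, of L UNIV])
       (use L valid_path_curve that in auto)
  then have "(\<lambda>w. contour_integral \<gamma> (\<lambda>\<zeta>. F \<zeta> / (\<zeta> - w))) holomorphic_on - path_image \<gamma>"
    by (meson ComplD field_differentiable_at_within field_differentiable_def holomorphic_onI)
  then show ?thesis unfolding cauchy_int_def by (intro holomorphic_intros) auto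
qed

lemma cauchy_int_tendsto_0: "(cauchy_int \<gamma> F \<longlongrightarrow> 0) at_infinity"
proof -
  obtain L where L: "0 \<le> L" "\<And>t. norm (\<gamma>' t) \<le> L" using deriv_bounded by auto
  obtain R where R: "\<And>x. x \<in> path_image \<gamma> \<Longrightarrow> norm x \<le> R"
    using bounded_simple_path_image[OF simple_path_curve] unfolding bounded_iff by auto
  have "bounded (F ` path_image \<gamma>)"
    by (intro compact_imp_bounded compact_continuous_image continuous_density compact_simple_path_image simple_path_curve)
  then obtain N where N: "\<And>x. x \<in> path_image \<gamma> \<Longrightarrow> norm (F x) \<le> N" unfolding bounded_iff by auto
  have N0: "0 \<le> N" using N[OF curve_in[of 0]] norm_ge_zero order_trans by blast
  have le: "norm (cauchy_int \<gamma> F z) \<le> N * L / (norm z - R)" if z: "norm z > R" for z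
  proof -
    have zn: "z \<notin> path_image \<gamma>" using R[of z] z by auto
    have "norm (integral {0..1} (\<lambda>t. (F (\<gamma> t) - 0) / (\<gamma> t - z) * \<gamma>' t)) \<le> integral {0..1} (\<lambda>t::real. N / (norm z - R) * L)"
    proof (rule integral_norm_bound_integral[OF integrable_off_curve[OF zn]])
      fix t :: real
      have "norm z \<le> norm (\<gamma> t) + norm (\<gamma> t - z)" by norm
      then have "norm z - R \<le> norm (\<gamma> t - z)" using R[OF curve_in[of t]] by linarith
      then show "norm ((F (\<gamma> t) - 0) / (\<gamma> t - z) * \<gamma>' t) \<le> N / (norm z - R) * L"
        unfolding norm_mult norm_divide using N[OF curve_in[of t]] L z N0
        by (intro mult_mono frac_le) auto
    qed auto
    then have "norm (contour_integral \<gamma> (\<lambda>\<zeta>. F \<zeta> / (\<zeta> - z))) \<le> N * L / (norm z - R)"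
      by (simp add: contour_integral_integral)
    moreover have "norm (cauchy_int \<gamma> F z) = norm (contour_integral \<gamma> (\<lambda>\<zeta>. F \<zeta> / (\<zeta> - z))) / (2 * pi)"
      by (simp add: cauchy_int_def norm_divide norm_mult)
    moreover have "norm (contour_integral \<gamma> (\<lambda>\<zeta>. F \<zeta> / (\<zeta> - z))) / (2 * pi) \<le> norm (contour_integral \<gamma> (\<lambda>\<zeta>. F \<zeta> / (\<zeta> - z))) / 1"
      using pi_ge_two by (intro divide_left_mono) auto
    ultimately show ?thesis by simp
  qed
  have "filterlim (\<lambda>z::complex. norm z - R) at_top at_infinity"
    using filterlim_tendsto_add_at_top[OF tendsto_const[of "-R"] filterlim_norm_at_top] by simp
  then have "((\<lambda>z::complex. N * L / (norm z - R)) \<longlongrightarrow> 0) at_infinity"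
    by (rule tendsto_divide_0[OF tendsto_const filterlim_at_top_imp_at_infinity])
  moreover have "\<forall>\<^sub>F z in at_infinity. norm (cauchy_int \<gamma> F z) \<le> N * L / (norm z - R)"
    unfolding eventually_at_infinity using le by (intro exI[of _ "R + 1"]) auto
  ultimately show ?thesis by (rule Lim_null_comparison[rotated])
qed

lemma cauchy_ext_interior:
  "holder_on \<sigma> (closure (inside (path_image \<gamma>))) (cauchy_ext 1)"
  "cauchy_ext 1 holomorphic_on inside (path_image \<gamma>)"
proof -
  show "holder_on \<sigma> (closure (inside (path_image \<gamma>))) (cauchy_ext 1)"
    unfolding jordan by (rule holder_on_cauchy_ext) (use winding_inside off_curve in auto)
  have "cauchy_int \<gamma> F holomorphic_on inside (path_image \<gamma>)"
    by (rule holomorphic_on_subset[OF cauchy_int_holomorphic]) (use off_curve in auto)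
  then show "cauchy_ext 1 holomorphic_on inside (path_image \<gamma>)"
    by (rule holomorphic_transform) (use off_curve in \<open>auto simp: cauchy_ext_def\<close>)
qed

lemma cauchy_ext_exterior:
  "holder_on \<sigma> (closure (outside (path_image \<gamma>))) (cauchy_ext 0)"
  "cauchy_ext 0 holomorphic_on outside (path_image \<gamma>)"
  "(cauchy_ext 0 \<longlongrightarrow> 0) at_infinity"
proof -
  show "holder_on \<sigma> (closure (outside (path_image \<gamma>))) (cauchy_ext 0)"
    unfolding jordan by (rule holder_on_cauchy_ext) (use winding_outside off_curve in auto)
  have "cauchy_int \<gamma> F holomorphic_on outside (path_image \<gamma>)"
    by (rule holomorphic_on_subset[OF cauchy_int_holomorphic]) (use off_curve in auto)
  then show "cauchy_ext 0 holomorphic_on outside (path_image \<gamma>)"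
    by (rule holomorphic_transform) (use off_curve in \<open>auto simp: cauchy_ext_def\<close>)
  obtain R where R: "\<And>x. x \<in> path_image \<gamma> \<Longrightarrow> norm x \<le> R"
    using bounded_simple_path_image[OF simple_path_curve] unfolding bounded_iff by auto
  have "\<forall>\<^sub>F z in at_infinity. cauchy_int \<gamma> F z = cauchy_ext 0 z"
    unfolding eventually_at_infinity cauchy_ext_def using R by (intro exI[of _ "R + 1"]) fastforce
  then show "(cauchy_ext 0 \<longlongrightarrow> 0) at_infinity"
    using cauchy_int_tendsto_0 tendsto_cong by blast
qed

text \<open>Both boundary values contain the same integral \<open>cauchy_diff z z\<close>; only the
  winding numbers 1 and 0, which multiply \<open>F z\<close>, differ.\<close>

lemma plemelj_jump: "z \<in> path_image \<gamma> \<Longrightarrow> cauchy_ext 1 z - cauchy_ext 0 z = F z"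
  by (simp add: cauchy_ext_def)

lemma hilbert_op_eq:
  assumes z: "z \<in> path_image \<gamma>"
  shows "hilbert_op \<gamma> F z = cauchy_ext 1 z"
proof -
  have zc: "z \<in> closure (inside (path_image \<gamma>))" "z \<notin> inside (path_image \<gamma>)" using z jordan(1) off_curve by auto
  \<comment> \<open>\<open>Lim\<close> is determined by convergence only along a nontrivial filter,
    so \<open>z\<close> has to be a limit point of the interior.\<close>
  then have nt: "at z within inside (path_image \<gamma>) \<noteq> bot"
    by (simp add: trivial_limit_within islimpt_in_closure)
  have "(cauchy_ext 1 \<longlongrightarrow> cauchy_ext 1 z) (at z within closure (inside (path_image \<gamma>)))"
    using holder_on_imp_continuous_on[OF cauchy_ext_interior(1) \<sigma>(1)] zc(1) unfolding continuous_on_def by blast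
  then have "(cauchy_ext 1 \<longlongrightarrow> cauchy_ext 1 z) (at z within inside (path_image \<gamma>))"
    by (rule tendsto_within_subset[OF _ closure_subset])
  moreover have "\<forall>\<^sub>F w in at z within inside (path_image \<gamma>). cauchy_ext 1 w = cauchy_int \<gamma> F w"
    using off_curve by (auto simp: eventually_at_filter cauchy_ext_def)
  ultimately have "(cauchy_int \<gamma> F \<longlongrightarrow> cauchy_ext 1 z) (at z within inside (path_image \<gamma>))"
    using tendsto_cong by blast
  then show ?thesis unfolding hilbert_op_def using nt by (rule tendsto_Lim[rotated])
qed

end

subsection \<open>Uniqueness and the fixed points\<close>

context regular_jordan_curve begin

text \<open>Near a real parameter \<open>G\<close> is injective and straightens the curve to the
  real axis. There \<open>h\<close> composed with \<open>G\<close> is continuous and holomorphic off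
  the axis, hence holomorphic across it, and composition with a local inverse of \<open>G\<close>
  returns \<open>h\<close>.\<close>

lemma holomorphic_across_curve:
  assumes "open S" and S: "\<And>t. complex_of_real t \<in> S" and G: "G holomorphic_on S"
    and \<gamma>_G: "\<And>t. \<gamma> t = G (complex_of_real t)" and G_nz: "\<And>t. deriv G (complex_of_real t) \<noteq> 0"
    and cont: "continuous_on UNIV h" and hol: "h holomorphic_on - path_image \<gamma>"
  shows "h holomorphic_on UNIV"
proof -
  have "h field_differentiable at p" for p
  proof (cases "p \<in> path_image \<gamma>")
    case False
    then show ?thesis
      using hol holomorphic_on_imp_differentiable_at closed_simple_path_image[OF simple_path_curve]
      by (metis ComplI open_Compl)
  next
    case True
    then obtain s where s: "p = \<gamma> s" by (auto simp: path_image_def)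
    obtain \<rho> where \<rho>: "0 < \<rho>" "ball (of_real s) \<rho> \<subseteq> S" "inj_on G (ball (of_real s) \<rho>)"
      using has_complex_derivative_locally_injective[OF G S \<open>open S\<close> G_nz] by blast
    obtain c where c: "0 < c" "\<And>s t. \<bar>t - s\<bar> \<le> 1/2 \<Longrightarrow> c * \<bar>t - s\<bar> \<le> norm (\<gamma> t - \<gamma> s)"
      using chord_arc by blast
    have "isCont G (of_real s)"
      using G S \<open>open S\<close> holomorphic_on_imp_continuous_on continuous_on_eq_continuous_at by blast
    then obtain \<rho>1 where \<rho>1: "0 < \<rho>1" "\<And>u. dist u (of_real s) < \<rho>1 \<Longrightarrow> dist (G u) (G (of_real s)) < c * \<rho>"
      unfolding continuous_at_eps_delta using c(1) \<rho>(1) by (metis mult_pos_pos)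
    \<comment> \<open>The radius \<rho> gives injectivity. The radius \<rho>1 keeps
      \<open>G u\<close> so close to \<open>p\<close> that, by the chord-arc bound, any curve point
      \<open>G u\<close> has a parameter within \<rho> of \<open>s\<close>.\<close>
    define B where "B = ball (complex_of_real s) (min \<rho> \<rho>1)"
    have B: "open B" "of_real s \<in> B" "B \<subseteq> S" "B \<subseteq> ball (of_real s) \<rho>"
      using \<rho> \<rho>1 by (auto simp: B_def)
    have injB: "inj_on G B" using \<rho>(3) B(4) by (rule inj_on_subset)
    have GB: "G holomorphic_on B" using G B(3) by (rule holomorphic_on_subset)
    \<comment> \<open>No distant portion of the curve returns near \<open>p\<close>, and on the
      nearby portion injectivity of \<open>G\<close> would force \<open>u\<close> to be
      real.\<close>
    have off: "G u \<notin> path_image \<gamma>" if u: "u \<in> B" "Im u \<noteq> 0" for u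
    proof
      assume "G u \<in> path_image \<gamma>"
      then obtain t0 where "\<gamma> t0 = G u" using range_curve by (metis rangeE)
      then obtain t where t: "\<gamma> t = G u" "\<bar>t - s\<bar> \<le> 1/2" using nearby_parameter by metis
      have "c * \<bar>t - s\<bar> \<le> norm (G u - G (of_real s))" using c(2)[OF t(2)] t(1) \<gamma>_G by simp
      also have "\<dots> < c * \<rho>" using \<rho>1(2)[of u] u(1) by (simp add: B_def dist_norm norm_minus_commute)
      finally have "\<bar>t - s\<bar> < \<rho>" using c(1) by simp
      moreover have "dist (complex_of_real s) (of_real t) = \<bar>t - s\<bar>"
        by (metis dist_norm norm_of_real of_real_diff abs_minus_commute)
      ultimately have "of_real t \<in> ball (complex_of_real s) \<rho>" by simp
      moreover have "G u = G (of_real t)" using t(1) \<gamma>_G by simp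
      ultimately have "u = of_real t" using \<rho>(3) u(1) B(4) by (meson inj_onD subsetD)
      then show False using u(2) by simp
    qed
    have contG: "continuous_on B G" using GB holomorphic_on_imp_continuous_on by blast
    have hG: "(\<lambda>u. h (G u)) holomorphic_on T" if "T \<subseteq> B" "\<And>u. u \<in> T \<Longrightarrow> Im u \<noteq> 0" for T
      by (rule holomorphic_on_compose_gen[OF holomorphic_on_subset[OF GB that(1)] hol, unfolded o_def])
         (use off that in auto)
    have "(\<lambda>u. h (G u)) holomorphic_on B"
    \<comment> \<open>The line is the real axis, with normal \<open>\<i>\<close> and offset
      0.\<close>
    proof (rule holomorphic_on_paste_across_line[OF B(1), of \<i> _ 0])
      show "continuous_on B (\<lambda>u. h (G u))" by (rule continuous_on_compose2[OF cont contG]) auto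
    qed (auto intro!: hG simp: inner_complex_def)
    moreover obtain g where g: "g holomorphic_on G ` B" "\<And>u. u \<in> B \<Longrightarrow> g (G u) = u"
      using holomorphic_has_inverse[OF GB B(1) injB] by metis
    moreover have "g ` G ` B \<subseteq> B" using g(2) by auto
    ultimately have "(\<lambda>z. h (G (g z))) holomorphic_on G ` B"
      using holomorphic_on_compose_gen[of g "G ` B" "\<lambda>u. h (G u)" B] by (simp add: o_def)
    then have "h holomorphic_on G ` B"
      by (rule holomorphic_transform) (use g(2) in auto)
    moreover have "open (G ` B)" by (rule open_mapping_thm3[OF GB B(1) injB])
    moreover have "p \<in> G ` B" using B(2) s \<gamma>_G by blast
    ultimately show ?thesis using holomorphic_on_imp_differentiable_at by blast
  qed
  then show ?thesis by (simp add: holomorphic_on_def)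
qed

end

section \<open>Closure properties of the function spaces\<close>

lemma holder_on_add:
  assumes "holder_on \<sigma> T f" "holder_on \<sigma> T g"
  shows "holder_on \<sigma> T (\<lambda>z. f z + g z)"
proof -
  obtain M N where "\<And>x y. x \<in> T \<Longrightarrow> y \<in> T \<Longrightarrow> norm (f x - f y) \<le> M * dist x y powr \<sigma>"
    "\<And>x y. x \<in> T \<Longrightarrow> y \<in> T \<Longrightarrow> norm (g x - g y) \<le> N * dist x y powr \<sigma>"
    using assms unfolding holder_on_def by blast
  then have "norm (f x + g x - (f y + g y)) \<le> (M + N) * dist x y powr \<sigma>" if "x \<in> T" "y \<in> T" for x y
    using that norm_diff_triangle_ineq[of "f x" "g x" "f y" "g y"] by (smt (verit) distrib_right)
  then show ?thesis unfolding holder_on_def by blast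
qed

lemma holder_on_uminus: "holder_on \<sigma> T f \<Longrightarrow> holder_on \<sigma> T (\<lambda>z. - f z)"
  unfolding holder_on_def by (simp add: norm_minus_commute)

lemma A_space_diff:
  assumes "f \<in> A_space \<sigma> \<Gamma>" "g \<in> A_space \<sigma> \<Gamma>"
  shows "(\<lambda>z. f z - g z) \<in> A_space \<sigma> \<Gamma>"
proof -
  obtain u v where u: "holder_on \<sigma> (closure (inside \<Gamma>)) u" "u holomorphic_on inside \<Gamma>" "\<forall>z\<in>\<Gamma>. f z = u z"
    and v: "holder_on \<sigma> (closure (inside \<Gamma>)) v" "v holomorphic_on inside \<Gamma>" "\<forall>z\<in>\<Gamma>. g z = v z"
    using assms unfolding A_space_def by blast
  have "holder_on \<sigma> (closure (inside \<Gamma>)) (\<lambda>z. u z + - v z)"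
    using u v by (intro holder_on_add holder_on_uminus)
  moreover have "(\<lambda>z. u z + - v z) holomorphic_on inside \<Gamma>" using u v by (intro holomorphic_intros)
  ultimately show ?thesis using u v unfolding A_space_def by auto
qed

lemma A'_space_add:
  assumes "f \<in> A'_space \<sigma> \<Gamma>" "g \<in> A'_space \<sigma> \<Gamma>"
  shows "(\<lambda>z. f z + g z) \<in> A'_space \<sigma> \<Gamma>"
proof -
  obtain u v where u: "holder_on \<sigma> (closure (outside \<Gamma>)) u" "u holomorphic_on outside \<Gamma>" "(u \<longlongrightarrow> 0) at_infinity" "\<forall>z\<in>\<Gamma>. f z = u z"
    and v: "holder_on \<sigma> (closure (outside \<Gamma>)) v" "v holomorphic_on outside \<Gamma>" "(v \<longlongrightarrow> 0) at_infinity" "\<forall>z\<in>\<Gamma>. g z = v z"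
    using assms unfolding A'_space_def by blast
  have "holder_on \<sigma> (closure (outside \<Gamma>)) (\<lambda>z. u z + v z)"
    using u v by (intro holder_on_add)
  moreover have "(\<lambda>z. u z + v z) holomorphic_on outside \<Gamma>" using u v by (intro holomorphic_intros)
  moreover have "((\<lambda>z. u z + v z) \<longlongrightarrow> 0) at_infinity" using tendsto_add[OF u(3) v(3)] by simp
  ultimately show ?thesis using u v unfolding A'_space_def by auto
qed

lemma A'_space_uminus:
  assumes "g \<in> A'_space \<sigma> \<Gamma>"
  shows "(\<lambda>z. - g z) \<in> A'_space \<sigma> \<Gamma>"
proof -
  obtain k where k: "holder_on \<sigma> (closure (outside \<Gamma>)) k" "k holomorphic_on outside \<Gamma>" "(k \<longlongrightarrow> 0) at_infinity" "\<forall>z\<in>\<Gamma>. g z = k z"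
    using assms unfolding A'_space_def by blast
  have "(\<lambda>z. - k z) holomorphic_on outside \<Gamma>" using k(2) by (intro holomorphic_intros)
  moreover have "((\<lambda>z. - k z) \<longlongrightarrow> 0) at_infinity" using tendsto_minus[OF k(3)] by simp
  ultimately show ?thesis unfolding A'_space_def using k holder_on_uminus[OF k(1)] by auto
qed

text \<open>Members are functions on the whole plane of which only the values on the curve count;
  equality on the curve therefore replaces equality of functions.\<close>

lemma A_space_cong: "f \<in> A_space \<sigma> \<Gamma> \<Longrightarrow> (\<And>z. z \<in> \<Gamma> \<Longrightarrow> f' z = f z) \<Longrightarrow> f' \<in> A_space \<sigma> \<Gamma>"
  unfolding A_space_def by auto

lemma A'_space_cong: "g \<in> A'_space \<sigma> \<Gamma> \<Longrightarrow> (\<And>z. z \<in> \<Gamma> \<Longrightarrow> g' z = g z) \<Longrightarrow> g' \<in> A'_space \<sigma> \<Gamma>"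
  unfolding A'_space_def by auto

lemma Lambda_sigma_conj: "F \<in> Lambda_sigma \<sigma> \<Gamma> \<Longrightarrow> conj_op F \<in> Lambda_sigma \<sigma> \<Gamma>"
  unfolding Lambda_sigma_def holder_on_def conj_op_def
  by (simp flip: complex_cnj_diff)

lemma const_in_A_space: "(\<lambda>z. c) \<in> A_space \<sigma> \<Gamma>"
  unfolding A_space_def holder_on_def by (auto intro!: exI[of _ "\<lambda>z. c"] exI[of _ 0])

section \<open>The direct sum decomposition and its projection\<close>

locale analytic_oriented_curve = regular_jordan_curve +
  fixes G :: "complex \<Rightarrow> complex" and S :: "complex set" and \<sigma> :: real
  assumes open_S: "open S" and S: "\<And>t. complex_of_real t \<in> S" and G: "G holomorphic_on S"
    and \<gamma>_G: "\<And>t. \<gamma> t = G (complex_of_real t)" and G_nz: "\<And>t. deriv G (complex_of_real t) \<noteq> 0"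
    and \<sigma>: "0 < \<sigma>" "\<sigma> < 1"
    and winding_inside: "\<And>z. z \<in> inside (path_image \<gamma>) \<Longrightarrow> winding_number \<gamma> z = 1"
begin

abbreviation "\<Gamma> \<equiv> path_image \<gamma>"

lemma glue_eq_0:
  assumes a: "continuous_on (closure (inside \<Gamma>)) a" "a holomorphic_on inside \<Gamma>"
    and b: "continuous_on (closure (outside \<Gamma>)) b" "b holomorphic_on outside \<Gamma>" "(b \<longlongrightarrow> 0) at_infinity"
    and ab: "\<And>z. z \<in> \<Gamma> \<Longrightarrow> a z = b z" and z: "z \<in> \<Gamma>"
  shows "a z = 0"
proof -
  \<comment> \<open>The two closures cover the plane and meet only in the curve, where
    \<open>a\<close> and \<open>b\<close> agree.\<close>
  define h where "h = (\<lambda>z. if z \<in> closure (inside \<Gamma>) then a z else b z)"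
  have io: "z \<in> \<Gamma>" if "z \<in> closure (inside \<Gamma>)" "z \<in> closure (outside \<Gamma>)" for z
    using that jordan by blast
  have all: "closure (inside \<Gamma>) \<union> closure (outside \<Gamma>) = UNIV" using jordan by blast
  have hb: "h z = b z" if "z \<in> closure (outside \<Gamma>)" for z using that io ab by (auto simp: h_def)
  have "continuous_on (closure (inside \<Gamma>) \<union> closure (outside \<Gamma>)) h"
  proof (rule continuous_on_closed_Un)
    show "continuous_on (closure (inside \<Gamma>)) h"
      using a(1) by (rule continuous_on_eq) (simp add: h_def)
    show "continuous_on (closure (outside \<Gamma>)) h"
      using b(1) by (rule continuous_on_eq) (simp add: hb)
  qed auto
  then have cont: "continuous_on UNIV h" by (simp add: all)
  have "h holomorphic_on inside \<Gamma>" "h holomorphic_on outside \<Gamma>"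
    using a(2) b(2) closure_subset[of "inside \<Gamma>"] closure_subset[of "outside \<Gamma>"] hb
    by (auto simp: h_def elim!: holomorphic_transform)
  then have "h holomorphic_on inside \<Gamma> \<union> outside \<Gamma>"
    using jordan by (intro holomorphic_on_Un)
  then have "h holomorphic_on - \<Gamma>" using jordan(5) by simp
  then have hol: "h holomorphic_on UNIV"
    using holomorphic_across_curve[OF open_S S G \<gamma>_G G_nz cont] by blast
  have "bounded (closure (inside \<Gamma>))"
    using Jordan_inside_outside[OF simple_path_curve closed_curve] by auto
  then obtain R where R: "\<And>z. z \<in> closure (inside \<Gamma>) \<Longrightarrow> norm z \<le> R" unfolding bounded_iff by auto
  have "\<forall>\<^sub>F z in at_infinity. b z = h z"
    unfolding eventually_at_infinity h_def using R by (intro exI[of _ "R + 1"]) fastforce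
  then have "(h \<longlongrightarrow> 0) at_infinity" using b(3) tendsto_cong by blast
  then have "h z = 0" using Liouville_weak_0[OF hol] by blast
  then show ?thesis using z jordan(1) by (simp add: h_def)
qed

lemma A_space_imp_Lambda: "F \<in> A_space \<sigma> \<Gamma> \<Longrightarrow> F \<in> Lambda_sigma \<sigma> \<Gamma>"
  unfolding A_space_def Lambda_sigma_def holder_on_def jordan by fastforce

lemma A'_space_imp_Lambda: "F \<in> A'_space \<sigma> \<Gamma> \<Longrightarrow> F \<in> Lambda_sigma \<sigma> \<Gamma>"
  unfolding A'_space_def Lambda_sigma_def holder_on_def jordan by fastforce

lemma A_Int_A'_eq_0:
  assumes "F \<in> A_space \<sigma> \<Gamma>" "F \<in> A'_space \<sigma> \<Gamma>" "z \<in> \<Gamma>"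
  shows "F z = 0"
proof -
  obtain f where f: "holder_on \<sigma> (closure (inside \<Gamma>)) f" "f holomorphic_on inside \<Gamma>" "\<forall>z\<in>\<Gamma>. F z = f z"
    using assms(1) unfolding A_space_def by blast
  obtain g where g: "holder_on \<sigma> (closure (outside \<Gamma>)) g" "g holomorphic_on outside \<Gamma>" "(g \<longlongrightarrow> 0) at_infinity" "\<forall>z\<in>\<Gamma>. F z = g z"
    using assms(2) unfolding A'_space_def by blast
  have "f z = 0"
    by (rule glue_eq_0[of f g]) (use f g assms(3) \<sigma> holder_on_imp_continuous_on in auto)
  then show ?thesis using f assms(3) by simp
qed

text \<open>On the curve the two functions are \<open>cauchy_ext 1\<close> and
  \<open>cauchy_ext 0\<close>; their difference is \<open>F\<close> by the jump relation.\<close>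

lemma plemelj_decomposition:
  assumes "F \<in> Lambda_sigma \<sigma> \<Gamma>"
  shows "hilbert_op \<gamma> F \<in> A_space \<sigma> \<Gamma>" "(\<lambda>z. hilbert_op \<gamma> F z - F z) \<in> A'_space \<sigma> \<Gamma>"
proof -
  obtain M where M: "\<And>x y. x \<in> \<Gamma> \<Longrightarrow> y \<in> \<Gamma> \<Longrightarrow> norm (F x - F y) \<le> M * dist x y powr \<sigma>"
    using assms unfolding Lambda_sigma_def holder_on_def by blast
  \<comment> \<open>\<open>holder_on\<close> leaves the sign of the constant open, whereas
    \<open>holder_density\<close> asks for a nonnegative one.\<close>
  have "norm (F x - F y) \<le> \<bar>M\<bar> * norm (x - y) powr \<sigma>" if "x \<in> \<Gamma>" "y \<in> \<Gamma>" for x y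
    using M[OF that] mult_right_mono[OF abs_ge_self[of M], of "norm (x - y) powr \<sigma>"] by (simp add: dist_norm)
  then interpret holder_density \<gamma> \<gamma>' F \<sigma> "\<bar>M\<bar>"
    by unfold_locales (use \<sigma> winding_inside in auto)
  show "hilbert_op \<gamma> F \<in> A_space \<sigma> \<Gamma>"
    unfolding A_space_def using cauchy_ext_interior hilbert_op_eq by blast
  have "\<forall>z\<in>\<Gamma>. hilbert_op \<gamma> F z - F z = cauchy_ext 0 z"
    using hilbert_op_eq plemelj_jump by (simp add: algebra_simps)
  then show "(\<lambda>z. hilbert_op \<gamma> F z - F z) \<in> A'_space \<sigma> \<Gamma>"
    unfolding A'_space_def using cauchy_ext_exterior by blast
qed

text \<open>The difference \<open>hilbert_op \<gamma> F z - F z\<close> belongs to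
  \<open>A'_space\<close> by the decomposition and to \<open>A_space\<close> because both terms do,
  so it vanishes on the curve.\<close>

lemma hilbert_op_A_space:
  assumes "F \<in> A_space \<sigma> \<Gamma>" "z \<in> \<Gamma>"
  shows "hilbert_op \<gamma> F z = F z"
proof -
  have "(\<lambda>z. hilbert_op \<gamma> F z - F z) \<in> A_space \<sigma> \<Gamma>"
    using plemelj_decomposition(1)[OF A_space_imp_Lambda] A_space_diff assms(1) by blast
  from A_Int_A'_eq_0[OF this plemelj_decomposition(2)[OF A_space_imp_Lambda] assms(2)] assms(1)
  show ?thesis by simp
qed

text \<open>Adding \<open>F\<close> to the exterior part
  \<open>hilbert_op \<gamma> F z - F z\<close> stays in \<open>A'_space\<close>, so
  \<open>hilbert_op \<gamma> F\<close> lies in both spaces.\<close>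

lemma hilbert_op_A'_space:
  assumes "F \<in> A'_space \<sigma> \<Gamma>" "z \<in> \<Gamma>"
  shows "hilbert_op \<gamma> F z = 0"
proof -
  note F = A'_space_imp_Lambda[OF assms(1)]
  have "hilbert_op \<gamma> F \<in> A'_space \<sigma> \<Gamma>"
    using A'_space_add[OF plemelj_decomposition(2)[OF F] assms(1)] by simp
  then show ?thesis using A_Int_A'_eq_0 plemelj_decomposition(1)[OF F] assms(2) by blast
qed

end

section \<open>Fixed points of \<open>Pi_op\<close> on an analytic Jordan curve\<close>

lemma analytic_jordan_curve_locale:
  assumes "analytic_jordan_curve \<gamma>" "0 < \<sigma>" "\<sigma> < 1" "\<forall>z\<in>inside (path_image \<gamma>). winding_number \<gamma> z = 1"
  obtains G S where "analytic_oriented_curve \<gamma> (\<lambda>t. deriv G (complex_of_real t)) G S \<sigma>"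
proof -
  obtain G S where G: "open S" "\<And>t. complex_of_real t \<in> S" "G holomorphic_on S"
      "\<And>t. \<gamma> t = G (complex_of_real t)" "\<And>t. deriv G (complex_of_real t) \<noteq> 0"
    and per: "\<And>t. \<gamma> (t + 1) = \<gamma> t" and inj: "inj_on \<gamma> {0..<1}"
    using assms(1) unfolding analytic_jordan_curve_def by blast
  have "(\<gamma> has_vector_derivative deriv G (of_real t)) (at t)" for t
  proof -
    have "(G has_field_derivative deriv G (of_real t)) (at (of_real t))"
      using holomorphic_derivI[OF G(3,1,2)] by blast
    then have "((\<lambda>t. G (of_real t)) has_vector_derivative deriv G (of_real t)) (at t)"
      by (rule has_vector_derivative_real_field)
    moreover have "\<gamma> = (\<lambda>t. G (of_real t))" using G(4) by auto
    ultimately show ?thesis by simp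
  qed
  moreover have "continuous_on UNIV (\<lambda>t. deriv G (complex_of_real t))"
    by (rule continuous_on_compose2[OF holomorphic_on_imp_continuous_on[OF holomorphic_deriv[OF G(3,1)]]])
       (use G(2) in \<open>auto intro!: continuous_intros\<close>)
  ultimately have "analytic_oriented_curve \<gamma> (\<lambda>t. deriv G (complex_of_real t)) G S \<sigma>"
    using G per inj assms by unfold_locales auto
  then show thesis by (rule that)
qed

theorem theorem1p20:
  fixes \<sigma> :: real and \<gamma> :: "real \<Rightarrow> complex"
  assumes "0 < \<sigma>" and "\<sigma> < 1"
    and "analytic_jordan_curve \<gamma>"
    and "\<forall>z\<in>inside (path_image \<gamma>). winding_number \<gamma> z = 1"
  shows "((\<exists>F\<in>Lambda_sigma \<sigma> (path_image \<gamma>).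
             (\<forall>z\<in>path_image \<gamma>. Pi_op \<gamma> F z = F z) \<and> (\<exists>z\<in>path_image \<gamma>. F z \<noteq> 0))
          \<longleftrightarrow>
          (\<exists>f\<in>A_space \<sigma> (path_image \<gamma>). \<exists>g\<in>A'_space \<sigma> (path_image \<gamma>).
             \<not> (\<exists>c. \<forall>z\<in>path_image \<gamma>. f z = c) \<and> \<not> (\<exists>c. \<forall>z\<in>path_image \<gamma>. g z = c) \<and>
             (\<forall>z\<in>path_image \<gamma>. f z = cnj (g z))))
       \<and> (\<forall>f\<in>A_space \<sigma> (path_image \<gamma>). \<forall>g\<in>A'_space \<sigma> (path_image \<gamma>).
             \<not> (\<exists>c. \<forall>z\<in>path_image \<gamma>. f z = c) \<and> \<not> (\<exists>c. \<forall>z\<in>path_image \<gamma>. g z = c) \<and>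
             (\<forall>z\<in>path_image \<gamma>. f z = cnj (g z)) \<longrightarrow>
             (\<forall>z\<in>path_image \<gamma>. Pi_op \<gamma> f z = f z) \<and> (\<forall>z\<in>path_image \<gamma>. Pi_op \<gamma> g z = g z))"
proof -
  obtain G S where "analytic_oriented_curve \<gamma> (\<lambda>t. deriv G (complex_of_real t)) G S \<sigma>"
    using analytic_jordan_curve_locale[OF assms(3,1,2,4)] by blast
  then interpret analytic_oriented_curve \<gamma> "\<lambda>t. deriv G (complex_of_real t)" G S \<sigma> .
  \<comment> \<open>Write H for \<open>hilbert_op\<close> and C for conjugation. On the curve H f =
    f and C H C f = C H g = 0, while H g = 0 and C H C g = C H f = C f = g.\<close>
  have fixed: "Pi_op \<gamma> f z = f z" "Pi_op \<gamma> g z = g z"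
    if f: "f \<in> A_space \<sigma> \<Gamma>" and g: "g \<in> A'_space \<sigma> \<Gamma>" and fg: "\<forall>z\<in>\<Gamma>. f z = cnj (g z)" and z: "z \<in> \<Gamma>" for f g z
  proof -
    have "conj_op f \<in> A'_space \<sigma> \<Gamma>" by (rule A'_space_cong[OF g]) (simp add: conj_op_def fg)
    then show "Pi_op \<gamma> f z = f z"
      using hilbert_op_A_space[OF f z] hilbert_op_A'_space[OF _ z] by (simp add: Pi_op_def conj_op_def)
    have "conj_op g \<in> A_space \<sigma> \<Gamma>" by (rule A_space_cong[OF f]) (simp add: conj_op_def fg)
    from hilbert_op_A_space[OF this z] show "Pi_op \<gamma> g z = g z"
      using hilbert_op_A'_space[OF g z] by (simp add: Pi_op_def conj_op_def)
  qed
  \<comment> \<open>If \<open>f\<close> is constant on the curve, so is its conjugate, which then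
    lies in both spaces. Hence for the pairs below nonvanishing implies nonconstancy.\<close>
  have vanish: "f z = 0"
    if f: "f \<in> A_space \<sigma> \<Gamma>" and cf: "(\<lambda>z. cnj (f z)) \<in> A'_space \<sigma> \<Gamma>" and c: "\<forall>z\<in>\<Gamma>. f z = c" and z: "z \<in> \<Gamma>" for f c z
  proof -
    have "(\<lambda>z. cnj (f z)) \<in> A_space \<sigma> \<Gamma>" by (rule A_space_cong[OF const_in_A_space[of "cnj c"]]) (simp add: c)
    from A_Int_A'_eq_0[OF this cf z] show ?thesis by simp
  qed
  have pair: "\<exists>f\<in>A_space \<sigma> \<Gamma>. \<exists>g\<in>A'_space \<sigma> \<Gamma>.
             \<not> (\<exists>c. \<forall>z\<in>\<Gamma>. f z = c) \<and> \<not> (\<exists>c. \<forall>z\<in>\<Gamma>. g z = c) \<and> (\<forall>z\<in>\<Gamma>. f z = cnj (g z))"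
    if f: "f \<in> A_space \<sigma> \<Gamma>" and cf: "(\<lambda>z. cnj (f z)) \<in> A'_space \<sigma> \<Gamma>" and z: "z \<in> \<Gamma>" "f z \<noteq> 0" for f z
  proof -
    have nc: "\<not> (\<exists>c. \<forall>z\<in>\<Gamma>. f z = c)" using vanish[OF f cf] z by blast
    then have "\<not> (\<exists>c. \<forall>z\<in>\<Gamma>. cnj (f z) = c)" by (metis complex_cnj_cnj)
    with nc show ?thesis by (intro bexI[OF _ f] bexI[OF _ cf]) auto
  qed
  have exists_pair: "\<exists>f\<in>A_space \<sigma> \<Gamma>. \<exists>g\<in>A'_space \<sigma> \<Gamma>.
             \<not> (\<exists>c. \<forall>z\<in>\<Gamma>. f z = c) \<and> \<not> (\<exists>c. \<forall>z\<in>\<Gamma>. g z = c) \<and> (\<forall>z\<in>\<Gamma>. f z = cnj (g z))"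
    if F: "F \<in> Lambda_sigma \<sigma> \<Gamma>" and Pi: "\<forall>z\<in>\<Gamma>. Pi_op \<gamma> F z = F z" and z: "z \<in> \<Gamma>" "F z \<noteq> 0" for F z
  proof -
    define f f1 where "f = hilbert_op \<gamma> F" and "f1 = hilbert_op \<gamma> (conj_op F)"
    have F_eq: "F z = f z + cnj (f1 z)" if "z \<in> \<Gamma>" for z
      using Pi that unfolding Pi_op_def f_def f1_def by (simp add: conj_op_def)
    have f: "f \<in> A_space \<sigma> \<Gamma>" "(\<lambda>z. f z - F z) \<in> A'_space \<sigma> \<Gamma>"
      unfolding f_def using plemelj_decomposition[OF F] .
    have f1: "f1 \<in> A_space \<sigma> \<Gamma>" "(\<lambda>z. f1 z - conj_op F z) \<in> A'_space \<sigma> \<Gamma>"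
      unfolding f1_def using plemelj_decomposition[OF Lambda_sigma_conj[OF F]] .
    \<comment> \<open>The fixed point equation reads F = f + C f1. Conjugated it gives C f = -(f1 -
      C F), and directly C f1 = -(f - F); both brackets are exterior parts.\<close>
    have cf: "(\<lambda>z. cnj (f z)) \<in> A'_space \<sigma> \<Gamma>"
      by (rule A'_space_cong[OF A'_space_uminus[OF f1(2)]]) (simp add: conj_op_def F_eq)
    have cf1: "(\<lambda>z. cnj (f1 z)) \<in> A'_space \<sigma> \<Gamma>"
      by (rule A'_space_cong[OF A'_space_uminus[OF f(2)]]) (simp add: F_eq)
    have "f z \<noteq> 0 \<or> f1 z \<noteq> 0" using F_eq[OF z(1)] z(2) by auto
    then show ?thesis using pair[OF f(1) cf z(1)] pair[OF f1(1) cf1 z(1)] by blast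
  qed
  show ?thesis
  proof (intro conjI iffI ballI impI)
    assume "\<exists>F\<in>Lambda_sigma \<sigma> \<Gamma>. (\<forall>z\<in>\<Gamma>. Pi_op \<gamma> F z = F z) \<and> (\<exists>z\<in>\<Gamma>. F z \<noteq> 0)"
    then show "\<exists>f\<in>A_space \<sigma> \<Gamma>. \<exists>g\<in>A'_space \<sigma> \<Gamma>.
             \<not> (\<exists>c. \<forall>z\<in>\<Gamma>. f z = c) \<and> \<not> (\<exists>c. \<forall>z\<in>\<Gamma>. g z = c) \<and> (\<forall>z\<in>\<Gamma>. f z = cnj (g z))"
      using exists_pair by blast
  next
    assume "\<exists>f\<in>A_space \<sigma> \<Gamma>. \<exists>g\<in>A'_space \<sigma> \<Gamma>.
             \<not> (\<exists>c. \<forall>z\<in>\<Gamma>. f z = c) \<and> \<not> (\<exists>c. \<forall>z\<in>\<Gamma>. g z = c) \<and> (\<forall>z\<in>\<Gamma>. f z = cnj (g z))"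
    then obtain f g where "f \<in> A_space \<sigma> \<Gamma>" "g \<in> A'_space \<sigma> \<Gamma>" "\<not> (\<exists>c. \<forall>z\<in>\<Gamma>. f z = c)" "\<forall>z\<in>\<Gamma>. f z = cnj (g z)"
      by blast
    \<comment> \<open>The fixed point is \<open>f\<close> itself, and it is not identically zero
      because it is not constant.\<close>
    then show "\<exists>F\<in>Lambda_sigma \<sigma> \<Gamma>. (\<forall>z\<in>\<Gamma>. Pi_op \<gamma> F z = F z) \<and> (\<exists>z\<in>\<Gamma>. F z \<noteq> 0)"
      using fixed(1) A_space_imp_Lambda by blast
  qed (use fixed in blast)+
qed

end
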